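(* Let $p$ be a prime with $p\equiv 1\pmod 3$, let $q$ be a prime with $q\equiv 1\pmod 4$ such that $p$ is a quadratic residue modulo $q$, and let $Q_1,\dots,Q_{14},S_1,\dots,S_{14}$ be the quadratic residue codes over $\mathcal{R}$ of length $q$ defined below. Then (i) $Q_i^\perp=S_{i+4}$ and $Q_{i+4}^\perp=S_i$ for $i=1,2,3,4$; (ii) $Q_j^\perp=S_{j+3}$ and $Q_{j+3}^\perp=S_j$ for $j=9,10,11$.
   Context: $\mathcal{R}=\mathbb{F}_p+u\mathbb{F}_p+u^2\mathbb{F}_p+u^3\mathbb{F}_p$ with $u^4=u$; $\mathcal{R}_q=\mathcal{R}[x]/\langle x^q-1\rangle$; cyclic codes of length $q$ are ideals of $\mathcal{R}_q$, $\langle\cdot\rangle$ is the ideal generated; duals are with respect to the Euclidean inner product on $\mathcal{R}^q$. $\xi\in\mathbb{F}_p$ is a primitive cube root of unity; $\eta_1=1-u^3$, $\eta_2=3^{-1}(u+u^2+u^3)$, $\eta_3=3^{-1}(\xi u+\xi^2u^2+u^3)$, $\eta_4=3^{-1}(\xi^2u+\xi u^2+u^3)$. With $Q_q,N_q$ the quadratic residues/non-residues mod $q$, $j_1=\sum_{i\in Q_q}x^i$, $j_2=\sum_{i\in N_q}x^i$, $\alpha$ a primitive $q$-th root of unity over $\mathbb{F}_p$, $\chi$ the Legendre symbol mod $q$, $\theta=\sum_{i=1}^{q-1}\chi(i)\alpha^i\in\mathbb{F}_p$: $e_1=\frac12(1+\frac1q)+\frac12(\frac1q-\frac1\theta)j_1+\frac12(\frac1q+\frac1\theta)j_2$,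 $e_2=\frac12(1+\frac1q)+\frac12(\frac1q-\frac1\theta)j_2+\frac12(\frac1q+\frac1\theta)j_1$, $\tilde e_1=\frac12(1-\frac1q)-\frac12(\frac1q+\frac1\theta)j_1-\frac12(\frac1q-\frac1\theta)j_2$, $\tilde e_2=\frac12(1-\frac1q)-\frac12(\frac1q+\frac1\theta)j_2-\frac12(\frac1q-\frac1\theta)j_1$. For $i=1,2,3,4$: $Q_i=\langle(1-\eta_i)e_1+\eta_ie_2\rangle$, $Q_{i+4}=\langle\eta_ie_1+(1-\eta_i)e_2\rangle$, $S_i=\langle(1-\eta_i)\tilde e_1+\eta_i\tilde e_2\rangle$, $S_{i+4}=\langle\eta_i\tilde e_1+(1-\eta_i)\tilde e_2\rangle$. For $k=9,10,11$ with $(i,j)=(1,2),(1,3),(1,4)$ respectively: $Q_k=\langle(\eta_i+\eta_j)e_1+(1-\eta_i-\eta_j)e_2\rangle$, $Q_{k+3}=\langle(\eta_i+\eta_j)e_2+(1-\eta_i-\eta_j)e_1\rangle$, $S_k=\langle(\eta_i+\eta_j)\tilde e_1+(1-\eta_i-\eta_j)\tilde e_2\rangle$, $S_{k+3}=\langle(\eta_i+\eta_j)\tilde e_2+(1-\eta_i-\eta_j)\tilde e_1\rangle$. *)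

theory Defs
  imports
    "HOL-Number_Theory.Number_Theory"
    "HOL-Algebra.QuotRing"
    "HOL-Algebra.Algebraic_Closure_Type"
    "Berlekamp_Zassenhaus.Finite_Field"
    "Jordan_Normal_Form.Matrix"
begin

hide_const (open) Divisibility.prime

text \<open>
  The prime field \<open>F\<^sub>p\<close> is \<open>'p mod_ring\<close>, where the type \<open>'p\<close> has \<open>p\<close> elements.  The ring
  \<open>R = F\<^sub>p + u F\<^sub>p + u\<^sup>2 F\<^sub>p + u\<^sup>3 F\<^sub>p\<close> with \<open>u\<^sup>4 = u\<close> is the quotient of \<open>F\<^sub>p[u]\<close> by the
  ideal generated by \<open>u\<^sup>4 - u\<close>.
\<close>

definition u_rel :: "'p::prime_card mod_ring poly" where
  "u_rel = monom 1 4 - monom 1 1"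

definition u_cong :: "'p::prime_card mod_ring poly \<Rightarrow> 'p mod_ring poly \<Rightarrow> bool" where
  "u_cong f g \<longleftrightarrow> u_rel dvd f - g"

lemma u_cong_equivp: "equivp (u_cong :: 'p::prime_card mod_ring poly \<Rightarrow> _)"
proof (rule equivpI)
  show "reflp (u_cong :: 'p mod_ring poly \<Rightarrow> _)" by (auto simp: reflp_def u_cong_def)
  show "symp (u_cong :: 'p mod_ring poly \<Rightarrow> _)" unfolding symp_def u_cong_def by (metis dvd_minus_iff minus_diff_eq)
  show "transp (u_cong :: 'p mod_ring poly \<Rightarrow> _)"
  proof (rule transpI)
    fix f g h :: "'p mod_ring poly"
    assume "u_cong f g" "u_cong g h"
    then have "u_rel dvd (f - g) + (g - h)" unfolding u_cong_def by (rule dvd_add)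
    then show "u_cong f h" by (simp add: u_cong_def)
  qed
qed

quotient_type 'p u_ring = "'p::prime_card mod_ring poly" / u_cong
  by (rule u_cong_equivp)

instantiation u_ring :: (prime_card) comm_ring_1
begin

lift_definition zero_u_ring :: "'a u_ring" is 0 .

lift_definition one_u_ring :: "'a u_ring" is 1 .

lift_definition plus_u_ring :: "'a u_ring \<Rightarrow> 'a u_ring \<Rightarrow> 'a u_ring" is "(+)"
  unfolding u_cong_def by (metis add_diff_add dvd_add)

lift_definition minus_u_ring :: "'a u_ring \<Rightarrow> 'a u_ring \<Rightarrow> 'a u_ring" is "(-)"
proof -
  fix a b c d :: "'a mod_ring poly"
  assume "u_cong a b" "u_cong c d"
  then have "u_rel dvd (a - b) - (c - d)" unfolding u_cong_def by (rule dvd_diff)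
  then show "u_cong (a - c) (b - d)" by (simp add: u_cong_def algebra_simps)
qed

lift_definition uminus_u_ring :: "'a u_ring \<Rightarrow> 'a u_ring" is uminus
  unfolding u_cong_def by (metis dvd_minus_iff minus_diff_minus)

lift_definition times_u_ring :: "'a u_ring \<Rightarrow> 'a u_ring \<Rightarrow> 'a u_ring" is "(*)"
proof -
  fix a b c d :: "'a mod_ring poly"
  assume "u_cong a b" "u_cong c d"
  then have "u_rel dvd (a - b) * c + b * (c - d)"
    unfolding u_cong_def by (intro dvd_add dvd_mult2 dvd_mult)
  then show "u_cong (a * c) (b * d)" by (simp add: u_cong_def algebra_simps)
qed

instance
proof
  show "(0 :: 'a u_ring) \<noteq> 1"
  proof (transfer, unfold u_cong_def, rule notI)
    assume "(u_rel :: 'a mod_ring poly) dvd 0 - 1"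
    then have "poly (u_rel :: 'a mod_ring poly) 0 dvd poly (0 - 1) 0"
      by (metis dvdE dvdI poly_mult)
    then show False by (simp add: u_rel_def poly_monom)
  qed
qed (transfer; simp add: u_cong_def algebra_simps)+

end

definition u_const :: "'p::prime_card mod_ring \<Rightarrow> 'p u_ring" where
  "u_const a = abs_u_ring [:a:]"

definition u_var :: "'p::prime_card u_ring" where
  "u_var = abs_u_ring [:0, 1:]"

lemma u_var_power4: "(u_var :: 'p::prime_card u_ring) ^ 4 = u_var"
proof -
  have "u_cong ([:0, 1:] * ([:0, 1:] * ([:0, 1:] * [:0, 1:]))) ([:0, 1:] :: 'p mod_ring poly)"
    by (simp add: u_cong_def u_rel_def monom_altdef numeral_eq_Suc)
  then have "abs_u_ring ([:0, 1:] * ([:0, 1:] * ([:0, 1:] * [:0, 1:]))) = (u_var :: 'p u_ring)"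
    unfolding u_var_def by (simp add: u_ring.abs_eq_iff)
  then show ?thesis by (simp add: u_var_def times_u_ring.abs_eq numeral_eq_Suc)
qed

lemma u_ring_representation:
  "\<exists>!(a, b, c, d). (r :: 'p::prime_card u_ring) =
     u_const a + u_const b * u_var + u_const c * u_var ^ 2 + u_const d * u_var ^ 3"
proof -
  have eq: "u_const a + u_const b * u_var + u_const c * u_var ^ 2 + u_const d * u_var ^ 3
      = abs_u_ring [:a, b, c, d:]" for a b c d :: "'p mod_ring"
    by (simp add: u_const_def u_var_def times_u_ring.abs_eq plus_u_ring.abs_eq numeral_eq_Suc)
  have deg: "degree (u_rel :: 'p mod_ring poly) = 4"
    by (simp add: u_rel_def monom_altdef numeral_eq_Suc)
  obtain f where f: "r = abs_u_ring f" using Quotient_abs_rep[OF Quotient_u_ring] by metis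
  define g where "g = f mod u_rel"
  have "u_rel dvd f - g" unfolding g_def by (simp add: minus_mod_eq_mult_div)
  then have rg: "r = abs_u_ring g" by (simp add: f u_ring.abs_eq_iff u_cong_def)
  have "degree g < 4"
    using degree_mod_less[of u_rel f] deg unfolding g_def by force
  have shape: "[:coeff h 0, coeff h 1, coeff h 2, coeff h 3:] = h"
    if "degree h < 4" for h :: "'p mod_ring poly"
  proof (rule poly_eqI)
    fix n
    show "coeff [:coeff h 0, coeff h 1, coeff h 2, coeff h 3:] n = coeff h n"
      using that by (auto simp: coeff_pCons coeff_eq_0 numeral_eq_Suc split: nat.split)
  qed
  show ?thesis
  proof (rule ex1I[of _ "(coeff g 0, coeff g 1, coeff g 2, coeff g 3)"])
    show "case (coeff g 0, coeff g 1, coeff g 2, coeff g 3) of (a, b, c, d) \<Rightarrow>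
        r = u_const a + u_const b * u_var + u_const c * u_var ^ 2 + u_const d * u_var ^ 3"
      unfolding eq prod.case using rg shape[OF \<open>degree g < 4\<close>] by simp
  next
    fix t :: "'p mod_ring \<times> 'p mod_ring \<times> 'p mod_ring \<times> 'p mod_ring"
    obtain a b c d where t: "t = (a, b, c, d)" by (metis prod_cases4)
    assume "case t of (a, b, c, d) \<Rightarrow>
        r = u_const a + u_const b * u_var + u_const c * u_var ^ 2 + u_const d * u_var ^ 3"
    then have "abs_u_ring [:a, b, c, d:] = abs_u_ring g" using rg by (simp add: t eq)
    then have dvd: "u_rel dvd [:a, b, c, d:] - g" by (simp add: u_ring.abs_eq_iff u_cong_def)
    have "degree [:a, b, c, d:] < 4" by (simp add: degree_pCons_eq_if)
    then have "degree ([:a, b, c, d:] - g) < 4" using \<open>degree g < 4\<close> by (rule degree_diff_less)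
    then have "[:a, b, c, d:] = g" using dvd_imp_degree_le[OF dvd] deg by fastforce
    then show "t = (coeff g 0, coeff g 1, coeff g 2, coeff g 3)"
      by (auto simp: t numeral_eq_Suc)
  qed
qed

text \<open>
  \<open>\<eta>\<^sub>1, \<dots>, \<eta>\<^sub>4\<close>; the argument \<open>\<xi>\<close> is a primitive cube root of unity in \<open>F\<^sub>p\<close>.
\<close>

definition primitive_root_of_unity :: "nat \<Rightarrow> 'a::field \<Rightarrow> bool" where
  "primitive_root_of_unity n z \<longleftrightarrow> n > 0 \<and> z ^ n = 1 \<and> (\<forall>k. 0 < k \<and> k < n \<longrightarrow> z ^ k \<noteq> 1)"

definition eta :: "'p::prime_card mod_ring \<Rightarrow> nat \<Rightarrow> 'p u_ring" where
  "eta \<xi> i =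
    (if i = 1 then 1 - u_var ^ 3
     else if i = 2 then u_const (inverse 3) * (u_var + u_var ^ 2 + u_var ^ 3)
     else if i = 3 then
       u_const (inverse 3) * (u_const \<xi> * u_var + u_const (\<xi> ^ 2) * u_var ^ 2 + u_var ^ 3)
     else if i = 4 then
       u_const (inverse 3) * (u_const (\<xi> ^ 2) * u_var + u_const \<xi> * u_var ^ 2 + u_var ^ 3)
     else undefined)"

definition quad_residues :: "nat \<Rightarrow> nat set" where
  "quad_residues q = {i \<in> {1..<q}. QuadRes (int q) (int i)}"

definition quad_nonresidues :: "nat \<Rightarrow> nat set" where
  "quad_nonresidues q = {i \<in> {1..<q}. \<not> QuadRes (int q) (int i)}"

definition j1 :: "nat \<Rightarrow> 'p::prime_card mod_ring poly" where
  "j1 q = (\<Sum>i\<in>quad_residues q. monom 1 i)"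

definition j2 :: "nat \<Rightarrow> 'p::prime_card mod_ring poly" where
  "j2 q = (\<Sum>i\<in>quad_nonresidues q. monom 1 i)"

text \<open>
  The root of unity \<open>\<alpha>\<close> lives in the algebraic closure of \<open>F\<^sub>p\<close>.  If \<open>p\<close> is a quadratic residue
  modulo \<open>q\<close>, the Gauss sum lies in \<open>F\<^sub>p\<close>, and \<^const>\<open>of_ac\<close> returns the element of \<open>F\<^sub>p\<close> that
  is mapped to it by the embedding \<^const>\<open>to_ac\<close>.
\<close>

definition theta :: "nat \<Rightarrow> 'p::prime_card mod_ring alg_closure \<Rightarrow> 'p mod_ring" where
  "theta q \<alpha> = of_ac (\<Sum>i = 1..q - 1. of_int (Legendre (int i) (int q)) * \<alpha> ^ i)"

definition e1 :: "nat \<Rightarrow> 'p::prime_card mod_ring \<Rightarrow> 'p mod_ring poly" where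
  "e1 q \<theta> = [:1 / 2 * (1 + 1 / of_nat q):]
     + smult (1 / 2 * (1 / of_nat q - 1 / \<theta>)) (j1 q)
     + smult (1 / 2 * (1 / of_nat q + 1 / \<theta>)) (j2 q)"

definition e2 :: "nat \<Rightarrow> 'p::prime_card mod_ring \<Rightarrow> 'p mod_ring poly" where
  "e2 q \<theta> = [:1 / 2 * (1 + 1 / of_nat q):]
     + smult (1 / 2 * (1 / of_nat q - 1 / \<theta>)) (j2 q)
     + smult (1 / 2 * (1 / of_nat q + 1 / \<theta>)) (j1 q)"

definition e1_tilde :: "nat \<Rightarrow> 'p::prime_card mod_ring \<Rightarrow> 'p mod_ring poly" where
  "e1_tilde q \<theta> = [:1 / 2 * (1 - 1 / of_nat q):]
     - smult (1 / 2 * (1 / of_nat q + 1 / \<theta>)) (j1 q)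
     - smult (1 / 2 * (1 / of_nat q - 1 / \<theta>)) (j2 q)"

definition e2_tilde :: "nat \<Rightarrow> 'p::prime_card mod_ring \<Rightarrow> 'p mod_ring poly" where
  "e2_tilde q \<theta> = [:1 / 2 * (1 - 1 / of_nat q):]
     - smult (1 / 2 * (1 / of_nat q + 1 / \<theta>)) (j2 q)
     - smult (1 / 2 * (1 / of_nat q - 1 / \<theta>)) (j1 q)"

text \<open>
  The ring \<open>R\<^sub>q = R[x] / (x\<^sup>q - 1)\<close>.  An element of \<open>R\<^sub>q\<close> is a coset, and a word
  \<open>(c\<^sub>0, \<dots>, c\<^bsub>q-1\<^esub>)\<close> over \<open>R\<close> is identified with the coset of \<open>c\<^sub>0 + c\<^sub>1 x + \<dots> + c\<^bsub>q-1\<^esub> x\<^bsup>q-1\<^esup>\<close>.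
\<close>

abbreviation type_poly_ring :: "'a::comm_ring_1 poly ring" where
  "type_poly_ring \<equiv> ring_of_type_algebra"

definition cyclic_ideal :: "nat \<Rightarrow> 'a::comm_ring_1 poly set" where
  "cyclic_ideal q = Idl\<^bsub>type_poly_ring\<^esub> {monom 1 q - 1}"

definition cyclic_ring :: "nat \<Rightarrow> 'a::comm_ring_1 poly set ring" where
  "cyclic_ring q = type_poly_ring Quot cyclic_ideal q"

definition cyclic_class :: "nat \<Rightarrow> 'a::comm_ring_1 poly \<Rightarrow> 'a poly set" where
  "cyclic_class q f = cyclic_ideal q +>\<^bsub>type_poly_ring\<^esub> f"

definition word_poly :: "'a::comm_ring_1 vec \<Rightarrow> 'a poly" where
  "word_poly v = (\<Sum>i<dim_vec v. monom (v $ i) i)"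

definition code_of_ideal :: "nat \<Rightarrow> 'a::comm_ring_1 poly set set \<Rightarrow> 'a vec set" where
  "code_of_ideal q I = {v \<in> carrier_vec q. cyclic_class q (word_poly v) \<in> I}"

definition cyclic_code :: "nat \<Rightarrow> 'a::comm_ring_1 poly \<Rightarrow> 'a vec set" where
  "cyclic_code q g = code_of_ideal q (Idl\<^bsub>cyclic_ring q\<^esub> {cyclic_class q g})"

definition dual_code :: "nat \<Rightarrow> 'a::comm_ring_1 vec set \<Rightarrow> 'a vec set" where
  "dual_code q C = {v \<in> carrier_vec q. \<forall>w\<in>C. v \<bullet> w = 0}"

text \<open>
  The codes \<open>Q\<^sub>k\<close> and \<open>S\<^sub>k\<close>, \<open>k = 1, \<dots>, 14\<close>, are generated by the same combinations of
  \<open>(e\<^sub>1, e\<^sub>2)\<close> and of \<open>(\<tilde>e\<^sub>1, \<tilde>e\<^sub>2)\<close>, respectively.  For \<open>k = 9, 10, 11\<close> the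
  pair of indices of \<open>\<eta>\<close> is \<open>(1, k - 7)\<close>; for \<open>k = 12, 13, 14\<close> it is that of \<open>k - 3\<close>.
\<close>

definition qr_generator ::
  "'p::prime_card mod_ring \<Rightarrow> 'p mod_ring poly \<Rightarrow> 'p mod_ring poly \<Rightarrow> nat \<Rightarrow> 'p u_ring poly" where
  "qr_generator \<xi> f1 f2 k =
    (let \<eta> = eta \<xi>; F1 = map_poly u_const f1; F2 = map_poly u_const f2 in
     if k \<in> {1..4} then smult (1 - \<eta> k) F1 + smult (\<eta> k) F2
     else if k \<in> {5..8} then smult (\<eta> (k - 4)) F1 + smult (1 - \<eta> (k - 4)) F2
     else if k \<in> {9..11} then
       smult (\<eta> 1 + \<eta> (k - 7)) F1 + smult (1 - \<eta> 1 - \<eta> (k - 7)) F2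
     else if k \<in> {12..14} then
       smult (\<eta> 1 + \<eta> (k - 10)) F2 + smult (1 - \<eta> 1 - \<eta> (k - 10)) F1
     else undefined)"

definition Q_code ::
  "nat \<Rightarrow> 'p::prime_card mod_ring \<Rightarrow> 'p mod_ring alg_closure \<Rightarrow> nat \<Rightarrow> 'p u_ring vec set" where
  "Q_code q \<xi> \<alpha> k =
    cyclic_code q (qr_generator \<xi> (e1 q (theta q \<alpha>)) (e2 q (theta q \<alpha>)) k)"

definition S_code ::
  "nat \<Rightarrow> 'p::prime_card mod_ring \<Rightarrow> 'p mod_ring alg_closure \<Rightarrow> nat \<Rightarrow> 'p u_ring vec set" where
  "S_code q \<xi> \<alpha> k =
    cyclic_code q (qr_generator \<xi> (e1_tilde q (theta q \<alpha>)) (e2_tilde q (theta q \<alpha>)) k)"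

end

(* An idempotent e of R[x]/(x^q - 1) that is invariant under x -> 1/x satisfies <e>^perp = <1 - e>.
   Put s = 1 + x + ... + x^(q-1) and c = j1 - j2.  All generators of the codes Q_k have the form
   1/2 + s/(2q) + b c with 4 q b^2 = 1: for an idempotent y of R the combination of e1 and e2 with
   coefficients 1 - y and y has b = -(1 - 2y)/(2 theta), and (1 - 2y)^2 = 1.  They are idempotent
   because s^2 = q s, s c = 0 and c^2 = q - s modulo x^q - 1, the last identity being the
   convolution of the Legendre symbol with itself for q = 1 (mod 4); in this case they are also
   invariant under x -> 1/x.  Evaluating c^2 = q - s at alpha gives theta^2 = q; quadratic
   reciprocity makes q a square modulo p, so that theta lies in F_p.  Finally e1~ = 1 - e2 and
   e2~ = 1 - e1. *)
theory Submission
  imports Defs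
begin

subsection \<open>Duals of ideals generated by a symmetric idempotent\<close>

text \<open>Calculations take place with representatives in \<open>R[x]\<close> instead of cosets in
  \<open>cyclic_ring q\<close>; \<open>cyclic_class_eq_iff\<close> translates between the
  two.\<close>

definition cyc_cong :: "nat \<Rightarrow> 'a::comm_ring_1 poly \<Rightarrow> 'a poly \<Rightarrow> bool" where
  "cyc_cong q f g \<longleftrightarrow> monom 1 q - 1 dvd f - g"

lemma cyc_cong_refl [simp]: "cyc_cong q f f"
  by (simp add: cyc_cong_def)

lemma cyc_cong_sym: "cyc_cong q f g \<Longrightarrow> cyc_cong q g f"
  unfolding cyc_cong_def by (metis dvd_minus_iff minus_diff_eq)

lemma cyc_cong_add: "cyc_cong q f g \<Longrightarrow> cyc_cong q f' g' \<Longrightarrow> cyc_cong q (f + f') (g + g')"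
  unfolding cyc_cong_def by (metis add_diff_add dvd_add)

lemma cyc_cong_trans [trans]: "cyc_cong q f g \<Longrightarrow> cyc_cong q g h \<Longrightarrow> cyc_cong q f h"
  using cyc_cong_add[of q f g g h] by (simp add: cyc_cong_def)

lemma cyc_cong_eq_trans [trans]: "cyc_cong q f g \<Longrightarrow> g = h \<Longrightarrow> cyc_cong q f h"
  "f = g \<Longrightarrow> cyc_cong q g h \<Longrightarrow> cyc_cong q f h"
  by simp_all

lemma cyc_cong_mult:
  assumes "cyc_cong q f g" "cyc_cong q f' g'"
  shows "cyc_cong q (f * f') (g * g')"
proof -
  have "f * f' - g * g' = (f - g) * f' + g * (f' - g')" by (simp add: algebra_simps)
  then show ?thesis using assms by (auto simp: cyc_cong_def)
qed

lemma cyc_cong_diff: "cyc_cong q f g \<Longrightarrow> cyc_cong q f' g' \<Longrightarrow> cyc_cong q (f - f') (g - g')"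
  using cyc_cong_add[of q f g "- f'" "- g'"]
  by (simp add: cyc_cong_def) (metis dvd_minus_iff minus_diff_eq)

lemma cyc_cong_smult: "cyc_cong q f g \<Longrightarrow> cyc_cong q (smult c f) (smult c g)"
  using cyc_cong_mult[of q "[:c:]" "[:c:]" f g] by simp

lemma cyc_cong_sum: "(\<And>i. i \<in> A \<Longrightarrow> cyc_cong q (f i) (g i)) \<Longrightarrow> cyc_cong q (sum f A) (sum g A)"
  by (induction A rule: infinite_finite_induct) (auto intro: cyc_cong_add)

lemma monom_1_power: "monom 1 n ^ k = (monom 1 (n * k) :: 'a::comm_ring_1 poly)"
  by (simp add: monom_power)

lemma cyc_cong_monom_mult: "cyc_cong q (monom 1 (q * k)) 1"
proof -
  have "monom 1 (q * k) - 1 = (monom 1 q :: 'a poly) ^ k - 1" by (simp add: monom_1_power)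
  then show ?thesis unfolding cyc_cong_def by (metis power_diff_1_eq dvd_triv_left)
qed

text \<open>As \<open>x^(q k)\<close> is congruent to 1, both exponents may be reduced to their
  remainder modulo \<open>q\<close>.\<close>

lemma cyc_cong_monom:
  assumes "[i = j] (mod q)"
  shows "cyc_cong q (monom a i) (monom a j)"
proof -
  have *: "cyc_cong q (monom a i) (monom a (i mod q))" for i
  proof -
    have "cyc_cong q (monom 1 (q * (i div q)) * monom a (i mod q)) (1 * monom a (i mod q))"
      by (intro cyc_cong_mult cyc_cong_monom_mult cyc_cong_refl)
    then show ?thesis by (simp add: mult_monom)
  qed
  show ?thesis using *[of i] *[of j] assms unfolding cong_def
    by (metis cyc_cong_sym cyc_cong_trans)
qed

text \<open>The constant coefficient of the reduction of \<open>f\<close> modulo \<open>x\<^sup>q - 1\<close>.\<close>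

definition cyc_const :: "nat \<Rightarrow> 'a::comm_ring_1 poly \<Rightarrow> 'a" where
  "cyc_const q f = (\<Sum>i\<le>degree f. if q dvd i then coeff f i else 0)"

lemma cyc_const_bound:
  assumes "degree f \<le> n"
  shows "cyc_const q f = (\<Sum>i\<le>n. if q dvd i then coeff f i else 0)"
  unfolding cyc_const_def
  by (rule sum.mono_neutral_left) (use assms in \<open>auto simp: coeff_eq_0\<close>)

lemma cyc_const_0 [simp]: "cyc_const q 0 = 0"
  by (simp add: cyc_const_def)

lemma cyc_const_add: "cyc_const q (f + g) = cyc_const q f + cyc_const q g"
proof -
  let ?n = "max (degree f) (degree g)"
  have "degree (f + g) \<le> ?n" by (simp add: degree_add_le)
  then show ?thesis
    by (simp add: cyc_const_bound[of _ ?n] sum.distrib[symmetric])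
       (simp add: if_distrib cong: if_cong)
qed

lemma cyc_const_diff: "cyc_const q (f - g) = cyc_const q f - cyc_const q g"
  using cyc_const_add[of q "f - g" g] by simp

lemma cyc_const_sum: "cyc_const q (sum f A) = (\<Sum>i\<in>A. cyc_const q (f i))"
  by (induction A rule: infinite_finite_induct) (auto simp: cyc_const_add)

lemma cyc_const_monom: "cyc_const q (monom a i) = (if q dvd i then a else 0)"
proof -
  have "cyc_const q (monom a i) = (\<Sum>j\<le>i. if j = i then (if q dvd i then a else 0) else 0)"
    unfolding cyc_const_bound[OF degree_monom_le] by (rule sum.cong) auto
  then show ?thesis by simp
qed

text \<open>Adding \<open>q\<close> to every exponent does not affect divisibility by
  \<open>q\<close>. This is what makes \<open>cyc_const\<close> well defined modulo
  \<open>x^q - 1\<close>.\<close>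

lemma cyc_const_shift: "cyc_const q (monom 1 q * f) = cyc_const q f"
proof -
  have "cyc_const q (monom 1 q * (\<Sum>i\<le>degree f. monom (coeff f i) i))
      = cyc_const q (\<Sum>i\<le>degree f. monom (coeff f i) i)"
    by (simp add: sum_distrib_left cyc_const_sum mult_monom cyc_const_monom)
  then show ?thesis by (simp add: poly_as_sum_of_monoms)
qed

lemma cyc_const_cong:
  assumes "cyc_cong q f g"
  shows "cyc_const q f = cyc_const q g"
proof -
  obtain h where "f - g = (monom 1 q - 1) * h" using assms unfolding cyc_cong_def by (elim dvdE)
  then have "cyc_const q (f - g) = 0"
    by (simp add: left_diff_distrib cyc_const_diff cyc_const_shift)
  then show ?thesis by (simp add: cyc_const_diff)
qed

text \<open>Modulo \<open>x\<^sup>q - 1\<close> this is the substitution of \<open>x\<^bsup>-1\<^esup>\<close> for \<open>x\<close>.\<close>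

definition cyc_rev :: "nat \<Rightarrow> 'a::comm_ring_1 poly \<Rightarrow> 'a poly" where
  "cyc_rev q f = pcompose f (monom 1 (q - 1))"

lemma cyc_rev_monom: "cyc_rev q (monom a i) = monom a ((q - 1) * i)"
  by (simp add: cyc_rev_def pcompose_altdef map_poly_monom poly_monom monom_1_power
      smult_monom flip: monom_altdef)

lemma cyc_rev_mult: "cyc_rev q (f * g) = cyc_rev q f * cyc_rev q g"
  by (simp add: cyc_rev_def pcompose_mult)

lemma cyc_rev_add: "cyc_rev q (f + g) = cyc_rev q f + cyc_rev q g"
  by (simp add: cyc_rev_def pcompose_add)

lemma cyc_rev_diff: "cyc_rev q (f - g) = cyc_rev q f - cyc_rev q g"
  by (simp add: cyc_rev_def pcompose_diff)

lemma cyc_rev_smult: "cyc_rev q (smult c f) = smult c (cyc_rev q f)"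
  by (simp add: cyc_rev_def pcompose_smult)

lemma cyc_rev_sum: "cyc_rev q (sum f A) = (\<Sum>i\<in>A. cyc_rev q (f i))"
  by (simp add: cyc_rev_def pcompose_sum)

lemma cyc_rev_const [simp]: "cyc_rev q [:c:] = [:c:]"
  by (simp add: cyc_rev_def)

text \<open>The substitution sends \<open>x^q - 1\<close> to \<open>x^(q(q-1)) - 1\<close>, again a
  multiple of \<open>x^q - 1\<close>.\<close>

lemma cyc_rev_cong:
  assumes "cyc_cong q f g"
  shows "cyc_cong q (cyc_rev q f) (cyc_rev q g)"
proof -
  obtain h where h: "f - g = (monom 1 q - 1) * h" using assms unfolding cyc_cong_def by (elim dvdE)
  have "cyc_rev q f - cyc_rev q g = (monom 1 (q * (q - 1)) - 1) * cyc_rev q h"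
    unfolding cyc_rev_diff[symmetric] h cyc_rev_mult
    using cyc_rev_monom[of q "1 :: 'a" q] cyc_rev_const[of q "1 :: 'a"]
    by (simp add: cyc_rev_diff mult.commute one_pCons)
  moreover have "monom 1 q - 1 dvd (monom 1 (q * (q - 1)) - 1 :: 'a poly)"
    using cyc_cong_monom_mult unfolding cyc_cong_def .
  ultimately show ?thesis unfolding cyc_cong_def by simp
qed

section \<open>Words, their polynomials and the inner product\<close>

lemma word_poly_add:
  "v \<in> carrier_vec q \<Longrightarrow> w \<in> carrier_vec q \<Longrightarrow> word_poly (v + w) = word_poly v + word_poly w"
  by (simp add: word_poly_def add_monom[symmetric] sum.distrib)

lemma word_poly_0 [simp]: "word_poly (0\<^sub>v q) = 0"
  by (simp add: word_poly_def)

lemma word_poly_unit: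
  assumes "i < q"
  shows "word_poly (a \<cdot>\<^sub>v unit_vec q i) = monom a i"
proof -
  have "word_poly (a \<cdot>\<^sub>v unit_vec q i) = (\<Sum>j<q. if j = i then monom a i else 0)"
    unfolding word_poly_def by (rule sum.cong) (auto simp: unit_vec_def)
  then show ?thesis using assms by simp
qed

text \<open>The reduction works one monomial at a time, folding the exponent \<open>i\<close> to
  \<open>i mod q\<close>, so that no polynomial division over the coefficient ring is
  involved.\<close>

lemma word_poly_reduction:
  assumes "q > 0"
  obtains v where "v \<in> carrier_vec q" "cyc_cong q f (word_poly v)"
proof -
  have "\<exists>v\<in>carrier_vec q. cyc_cong q (\<Sum>i\<in>A. monom (coeff f i) i) (word_poly v)" if "finite A" for A
    using that
  proof (induction A)
    case empty
    show ?case by (rule bexI[of _ "0\<^sub>v q"]) auto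
  next
    case (insert i A)
    then obtain v where v: "v \<in> carrier_vec q"
      "cyc_cong q (\<Sum>i\<in>A. monom (coeff f i) i) (word_poly v)" by blast
    have "cyc_cong q (monom (coeff f i) i) (word_poly (coeff f i \<cdot>\<^sub>v unit_vec q (i mod q)))"
      using assms by (simp add: word_poly_unit cyc_cong_monom cong_def)
    then have "cyc_cong q (\<Sum>i\<in>insert i A. monom (coeff f i) i)
        (word_poly (coeff f i \<cdot>\<^sub>v unit_vec q (i mod q) + v))"
      using insert v by (simp add: word_poly_add[of _ q] cyc_cong_add)
    then show ?case using v(1) by (intro bexI[of _ "coeff f i \<cdot>\<^sub>v unit_vec q (i mod q) + v"]) auto
  qed
  from this[of "{..degree f}"] show ?thesis
    using that by (auto simp: poly_as_sum_of_monoms)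
qed

text \<open>In \<open>v(x) w(1/x)\<close> the term from \<open>v_i\<close> and \<open>w_j\<close>
  has exponent \<open>i - j\<close> modulo \<open>q\<close>, so exactly the terms with
  \<open>i = j\<close> reach the constant coefficient. Orthogonality thereby becomes a statement
  about products of polynomials.\<close>

lemma scalar_prod_eq_cyc_const:
  assumes "v \<in> carrier_vec q" "w \<in> carrier_vec q"
  shows "v \<bullet> w = cyc_const q (word_poly v * cyc_rev q (word_poly w))"
proof -
  have dvd_iff: "q dvd i + (q - 1) * j \<longleftrightarrow> i = j" if "i < q" "j < q" for i j
  proof -
    \<comment> \<open>Passing to integers shows that \<open>(q - 1) * j\<close> acts as
      \<open>-j\<close> modulo \<open>q\<close>.\<close>
    have "int (i + (q - 1) * j) = int q * int j + (int i - int j)"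
      using that by (simp add: of_nat_diff left_diff_distrib)
    then have "int q dvd int (i + (q - 1) * j) \<longleftrightarrow> int q dvd int i - int j"
      by (simp only: dvd_add_right_iff[OF dvd_triv_left])
    also have "\<dots> \<longleftrightarrow> i = j"
      using that zdvd_imp_le[of "int q" "int i - int j"] zdvd_imp_le[of "int q" "int j - int i"]
      by (cases i j rule: linorder_cases) (auto simp: dvd_diff_commute)
    finally show ?thesis unfolding int_dvd_int_iff .
  qed
  have "cyc_const q (word_poly v * cyc_rev q (word_poly w))
      = (\<Sum>i<q. \<Sum>j<q. if q dvd i + (q - 1) * j then v $ i * w $ j else 0)"
    using assms
    by (simp add: word_poly_def cyc_rev_sum cyc_rev_monom sum_product cyc_const_sum mult_monom
        cyc_const_monom)
  also have "\<dots> = (\<Sum>i<q. \<Sum>j<q. if i = j then v $ i * w $ j else 0)"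
    by (intro sum.cong refl if_cong dvd_iff) simp_all
  also have "\<dots> = v \<bullet> w"
    using assms by (simp add: scalar_prod_def lessThan_atLeast0)
  finally show ?thesis ..
qed

section \<open>Cyclic codes as principal ideals of the quotient ring\<close>

lemma ring_of_type_algebra_simps:
  "carrier (ring_of_type_algebra :: 'a::comm_ring_1 ring) = UNIV"
  "a \<otimes>\<^bsub>ring_of_type_algebra\<^esub> b = (a * b :: 'a)"
  "a \<oplus>\<^bsub>ring_of_type_algebra\<^esub> b = (a + b :: 'a)"
  "\<zero>\<^bsub>ring_of_type_algebra\<^esub> = (0 :: 'a)"
  by (simp_all add: ring_of_type_algebra_def)

lemma ring_of_type_algebra_minus:
  "a \<ominus>\<^bsub>ring_of_type_algebra\<^esub> b = (a - b :: 'a::comm_ring_1)"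
proof -
  interpret cring "ring_of_type_algebra :: 'a ring" by (rule cring_from_type_algebra)
  have "(a \<ominus>\<^bsub>ring_of_type_algebra\<^esub> b) \<oplus>\<^bsub>ring_of_type_algebra\<^esub> b = a"
    by (simp add: ring_of_type_algebra_simps(1) a_minus_def a_assoc l_neg)
  then show ?thesis by (simp add: ring_of_type_algebra_simps eq_diff_eq)
qed

lemma cyclic_ideal_eq:
  "cyclic_ideal q = range (\<lambda>h. h * (monom 1 q - 1 :: 'a::comm_ring_1 poly))"
proof -
  interpret cring "type_poly_ring :: 'a poly ring" by (rule cring_from_type_algebra)
  show ?thesis unfolding cyclic_ideal_def
    by (subst cgenideal_eq_genideal[symmetric])
       (auto simp: cgenideal_def ring_of_type_algebra_simps)
qed

lemma ideal_cyclic_ideal: "ideal (cyclic_ideal q) (type_poly_ring :: 'a::comm_ring_1 poly ring)"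
proof -
  interpret cring "type_poly_ring :: 'a poly ring" by (rule cring_from_type_algebra)
  show ?thesis unfolding cyclic_ideal_def
    by (rule genideal_ideal) (simp add: ring_of_type_algebra_simps)
qed

lemma cyclic_class_eq_iff:
  "cyclic_class q f = cyclic_class q (g :: 'a::comm_ring_1 poly) \<longleftrightarrow> cyc_cong q f g"
proof -
  interpret cring "type_poly_ring :: 'a poly ring" by (rule cring_from_type_algebra)
  have "cyclic_class q f = cyclic_class q g \<longleftrightarrow> f - g \<in> cyclic_ideal q"
    unfolding cyclic_class_def ring_of_type_algebra_minus[symmetric]
    by (rule quotient_eq_iff_same_a_r_cos[OF ideal_cyclic_ideal, symmetric])
       (simp_all add: ring_of_type_algebra_simps)
  then show ?thesis by (auto simp: cyclic_ideal_eq cyc_cong_def dvd_def mult.commute)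
qed

text \<open>In a commutative ring the ideal generated by one element consists of its multiples, and
  cosets multiply through representatives. All later arguments about codes rest on this
  description.\<close>

lemma cyclic_code_iff:
  "v \<in> cyclic_code q (g :: 'a::comm_ring_1 poly)
    \<longleftrightarrow> v \<in> carrier_vec q \<and> (\<exists>h. cyc_cong q (word_poly v) (h * g))"
proof -
  interpret I: ideal "cyclic_ideal q" "type_poly_ring :: 'a poly ring" by (rule ideal_cyclic_ideal)
  interpret Q: cring "cyclic_ring q :: 'a poly set ring"
    unfolding cyclic_ring_def by (rule I.quotient_is_cring) (rule cring_from_type_algebra)
  have carrier: "carrier (cyclic_ring q) = range (cyclic_class q :: 'a poly \<Rightarrow> _)"
    unfolding cyclic_ring_def FactRing_simps cyclic_class_def
    by (auto simp: ring_of_type_algebra_simps(1))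
  have mult: "cyclic_class q h \<otimes>\<^bsub>cyclic_ring q\<^esub> cyclic_class q g = cyclic_class q (h * g)"
    for h g :: "'a poly"
    using I.rcoset_mult_add[of h g]
    by (simp add: cyclic_ring_def FactRing_def cyclic_class_def ring_of_type_algebra_simps)
  have "Idl\<^bsub>cyclic_ring q\<^esub> {cyclic_class q g} = range (\<lambda>h. cyclic_class q (h * g))"
    by (subst Q.cgenideal_eq_genideal[symmetric])
       (auto simp: cgenideal_def carrier mult[symmetric])
  then show ?thesis
    by (auto simp: cyclic_code_def code_of_ideal_def cyclic_class_eq_iff image_iff)
qed

text \<open>By symmetry of \<open>e\<close>, multiplication by \<open>e\<close> is self-adjoint for
  the inner product. Hence \<open>v\<close> is orthogonal to all multiples of \<open>e\<close> iff
  \<open>e v = 0\<close>, and since \<open>e\<close> is idempotent, this holds iff \<open>v\<close>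
  is a multiple of \<open>1 - e\<close>.\<close>

lemma dual_code_idempotent:
  fixes e :: "'a::comm_ring_1 poly"
  assumes "q > 0" and idem: "cyc_cong q (e * e) e" and symm: "cyc_cong q (cyc_rev q e) e"
  shows "dual_code q (cyclic_code q e) = cyclic_code q (1 - e)"
proof (intro Set.set_eqI iffI)
  fix v assume "v \<in> dual_code q (cyclic_code q e)"
  then have v: "v \<in> carrier_vec q" and orth: "\<And>w. w \<in> cyclic_code q e \<Longrightarrow> v \<bullet> w = 0"
    by (auto simp: dual_code_def)
  obtain u where u: "u \<in> carrier_vec q" "cyc_cong q (e * word_poly v) (word_poly u)"
    using word_poly_reduction[OF \<open>q > 0\<close>] by blast
  have "u $ i = 0" if "i < q" for i
  proof -
    obtain w where w: "w \<in> carrier_vec q" "cyc_cong q (monom 1 i * e) (word_poly w)"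
      using word_poly_reduction[OF \<open>q > 0\<close>] by blast
    then have "w \<in> cyclic_code q e" unfolding cyclic_code_iff using cyc_cong_sym by blast
    \<comment> \<open>The coordinate \<open>u_i\<close> is the inner product of \<open>e v\<close>
      with \<open>x^i\<close>. Moving \<open>e\<close> to the other side gives the inner product of
      \<open>v\<close> with the codeword \<open>x^i e\<close>, which is 0.\<close>
    have "u $ i = u \<bullet> unit_vec q i" using u(1) that by (simp add: scalar_prod_right_unit)
    also have "\<dots> = cyc_const q (word_poly u * cyc_rev q (monom 1 i))"
      using scalar_prod_eq_cyc_const[OF u(1), of "unit_vec q i"] word_poly_unit[OF that, of "1 :: 'a"]
      by (simp add: one_smult_vec)
    also have "\<dots> = cyc_const q (word_poly v * cyc_rev q (word_poly w))"
    proof (rule cyc_const_cong)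
      have "cyc_cong q (word_poly u * cyc_rev q (monom 1 i))
          ((e * word_poly v) * cyc_rev q (monom 1 i))"
        by (intro cyc_cong_mult cyc_cong_sym[OF u(2)] cyc_cong_refl)
      also have "\<dots> = word_poly v * (cyc_rev q (monom 1 i) * e)" by (simp add: ac_simps)
      also have "cyc_cong q \<dots> (word_poly v * (cyc_rev q (monom 1 i) * cyc_rev q e))"
        by (intro cyc_cong_mult cyc_cong_sym[OF symm] cyc_cong_refl)
      also have "\<dots> = word_poly v * cyc_rev q (monom 1 i * e)" by (simp add: cyc_rev_mult)
      also have "cyc_cong q \<dots> (word_poly v * cyc_rev q (word_poly w))"
        by (intro cyc_cong_mult cyc_rev_cong w(2) cyc_cong_refl)
      finally show "cyc_cong q (word_poly u * cyc_rev q (monom 1 i))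
        (word_poly v * cyc_rev q (word_poly w))" .
    qed
    also have "\<dots> = 0"
      using orth[OF \<open>w \<in> cyclic_code q e\<close>] scalar_prod_eq_cyc_const[OF v w(1)] by simp
    finally show ?thesis .
  qed
  then have "u = 0\<^sub>v q" using u(1) by auto
  \<comment> \<open>As \<open>e v\<close> vanishes, \<open>v = v - e v = v (1 - e)\<close>.\<close>
  then have "cyc_cong q (word_poly v - 0) (word_poly v - e * word_poly v)"
    using u(2) by (intro cyc_cong_diff cyc_cong_refl) (simp add: cyc_cong_sym)
  then have "cyc_cong q (word_poly v) (word_poly v * (1 - e))"
    by (simp add: algebra_simps)
  then show "v \<in> cyclic_code q (1 - e)" unfolding cyclic_code_iff using v by blast
next
  fix v assume "v \<in> cyclic_code q (1 - e)"
  then obtain h where v: "v \<in> carrier_vec q" and h: "cyc_cong q (word_poly v) (h * (1 - e))"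
    unfolding cyclic_code_iff by blast
  have "v \<bullet> w = 0" if w_code: "w \<in> cyclic_code q e" for w
  proof -
    obtain k where w: "w \<in> carrier_vec q" and k: "cyc_cong q (word_poly w) (k * e)"
      using w_code unfolding cyclic_code_iff by blast
    have "cyc_cong q (cyc_rev q (word_poly w)) (cyc_rev q (k * e))" by (rule cyc_rev_cong[OF k])
    also have "\<dots> = cyc_rev q k * cyc_rev q e" by (rule cyc_rev_mult)
    also have "cyc_cong q \<dots> (cyc_rev q k * e)" by (intro cyc_cong_mult symm cyc_cong_refl)
    finally have "cyc_cong q (word_poly v * cyc_rev q (word_poly w))
        (h * (1 - e) * (cyc_rev q k * e))"
      by (intro cyc_cong_mult h)
    also have "\<dots> = h * cyc_rev q k * (e - e * e)" by (simp add: algebra_simps)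
    also have "cyc_cong q \<dots> (h * cyc_rev q k * (e - e))"
      by (intro cyc_cong_mult cyc_cong_diff idem cyc_cong_refl)
    finally show ?thesis
      using scalar_prod_eq_cyc_const[OF v w] cyc_const_cong by fastforce
  qed
  then show "v \<in> dual_code q (cyclic_code q e)" using v by (simp add: dual_code_def)
qed

subsection \<open>Sums of Legendre symbols\<close>

text \<open>Turns congruences modulo \<open>q\<close> into equalities: two values of the Legendre
  symbol differ by at most 2, which is less than \<open>q\<close>.\<close>

lemma dvd_less_imp_0: "d dvd k \<Longrightarrow> \<bar>k\<bar> < d \<Longrightarrow> k = 0" for d k :: int
  using dvd_imp_le_int[of k d] by linarith

lemma Legendre_cong:
  assumes "[a = b] (mod q)"
  shows "Legendre a q = Legendre b q"
proof -
  have "[a = c] (mod q) \<longleftrightarrow> [b = c] (mod q)" "[c = a] (mod q) \<longleftrightarrow> [c = b] (mod q)" for c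
    using assms by (auto simp: cong_def)
  then show ?thesis by (simp add: Legendre_def QuadRes_def)
qed

lemma Legendre_mod [simp]: "Legendre (a mod q) q = Legendre a q"
  by (rule Legendre_cong) simp

lemma Legendre_mult:
  fixes q :: nat
  assumes "prime q" "q > 2"
  shows "Legendre (a * b) (int q) = Legendre a q * Legendre b q"
proof -
  let ?k = "(q - 1) div 2"
  have "[Legendre (a * b) q = (a * b) ^ ?k] (mod q)" by (rule euler_criterion[OF assms])
  also have "(a * b) ^ ?k = a ^ ?k * b ^ ?k" by (rule power_mult_distrib)
  also have "[\<dots> = Legendre a q * Legendre b q] (mod q)"
    by (intro cong_mult cong_sym[OF euler_criterion[OF assms]])
  finally have "int q dvd Legendre (a * b) q - Legendre a q * Legendre b q"
    by (simp add: cong_iff_dvd_diff)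
  moreover have "\<bar>Legendre (a * b) q - Legendre a q * Legendre b q\<bar> < int q"
    using assms(2) by (auto simp: Legendre_def)
  ultimately have "Legendre (a * b) q - Legendre a q * Legendre b q = 0"
    by (rule dvd_less_imp_0)
  then show ?thesis by simp
qed

lemma Legendre_square:
  assumes "\<not> int q dvd a"
  shows "Legendre a (int q) * Legendre a q = 1"
  using assms by (auto simp: Legendre_def cong_0_iff)

text \<open>For \<open>q = 1\<close> modulo 4 the exponent \<open>(q - 1) / 2\<close> in Euler's
  criterion is even, so -1 is a quadratic residue.\<close>

lemma Legendre_minus:
  fixes q :: nat
  assumes "prime q" "[q = 1] (mod 4)"
  shows "Legendre (- a) (int q) = Legendre a q"
proof -
  from assms have "q mod 4 = 1" by (simp add: cong_def)
  moreover have "q \<noteq> 1" using assms by auto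
  ultimately have q: "q > 2" "even ((q - 1) div 2)" by presburger+
  have "[Legendre (-1) q = (-1) ^ ((q - 1) div 2)] (mod q)"
    by (rule euler_criterion) (use assms q in auto)
  then have "[Legendre (-1) q = 1] (mod q)" using q by simp
  then have "int q dvd Legendre (-1) q - 1"
    by (simp add: cong_iff_dvd_diff)
  moreover have "\<bar>Legendre (-1) q - 1\<bar> < int q" using q by (auto simp: Legendre_def)
  ultimately have "Legendre (-1) q - 1 = 0" by (rule dvd_less_imp_0)
  then have "Legendre (-1) q = 1" by simp
  then show ?thesis using Legendre_mult[OF assms(1) q(1), of "-1" a] by simp
qed

text \<open>The maps \<open>f\<close> and \<open>g\<close> are inverse to each other modulo
  \<open>q\<close> and so permute the residues, while \<open>F\<close> is periodic. Taking arguments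
  in the integers allows differences and negatives in the summands.\<close>

lemma sum_residues_reindex:
  fixes F :: "int \<Rightarrow> 'b::comm_monoid_add" and f g :: "int \<Rightarrow> int"
  assumes "q > 0" and F: "\<And>a. F (a mod int q) = F a"
    and fg: "\<And>a. f (g a mod q) mod q = a mod q" and gf: "\<And>a. g (f a mod q) mod q = a mod q"
  shows "(\<Sum>i<q. F (f (int i))) = (\<Sum>i<q. F (int i))"
proof (rule sum.reindex_bij_witness[where i="\<lambda>i. nat (g (int i) mod q)"
      and j="\<lambda>i. nat (f (int i) mod q)"])
  fix i assume "i \<in> {..<q}"
  then have i: "int i mod int q = int i" by simp
  show "nat (g (int (nat (f (int i) mod q))) mod q) = i"
    using assms(1) by (simp add: gf i del: int_ops)
  show "nat (f (int (nat (g (int i) mod q))) mod q) = i"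
    using assms(1) by (simp add: fg i del: int_ops)
  show "nat (f (int i) mod q) \<in> {..<q}" "nat (g (int i) mod q) \<in> {..<q}"
    using assms(1) by (simp_all add: nat_less_iff)
  show "F (int (nat (f (int i) mod q))) = F (f (int i))"
    using assms(1) by (simp add: F)
qed

lemma sum_residues_shift:
  fixes F :: "int \<Rightarrow> 'b::comm_monoid_add"
  assumes "q > 0" and F: "\<And>a. F (a mod int q) = F a"
  shows "(\<Sum>i<q. F (int i + b)) = (\<Sum>i<q. F (int i))"
  by (rule sum_residues_reindex[where f="\<lambda>a. a + b" and g="\<lambda>a. a - b" and F=F, OF assms])
     (simp_all add: mod_simps)

lemma sum_residues_mult:
  fixes F :: "int \<Rightarrow> 'b::comm_monoid_add"
  assumes "coprime b (int q)" "q > 0" and F: "\<And>a. F (a mod int q) = F a"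
  shows "(\<Sum>i<q. F (b * int i)) = (\<Sum>i<q. F (int i))"
proof -
  obtain c where c: "[b * c = 1] (mod int q)" using assms(1) cong_solve_coprime_int by blast
  have "(b * (c * a)) mod int q = a mod q" for a
    using cong_scalar_right[OF c, of a] by (simp add: cong_def mult.assoc)
  then have bc: "(b * (c * a mod int q)) mod int q = a mod q"
    "(c * (b * a mod int q)) mod int q = a mod q" for a
    by (simp_all add: mod_mult_right_eq mult.left_commute)
  show ?thesis
    by (rule sum_residues_reindex[where f="\<lambda>a. b * a" and g="\<lambda>a. c * a" and F=F, OF assms(2,3) bc])
qed

text \<open>Squaring on the nonzero residues is not injective, because 1 and \<open>q - 1\<close>
  have the same square. On a finite set it then misses some value, which is a nonresidue.\<close>

lemma exists_Legendre_nonresidue: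
  fixes q :: nat
  assumes "prime q" "q > 2"
  obtains b where "coprime b (int q)" "Legendre b q = -1"
proof -
  let ?f = "\<lambda>i::nat. i ^ 2 mod q"
  have "\<not> inj_on ?f {1..<q}"
  proof
    have "(q - 1) ^ 2 mod q = 1"
    proof -
      have "(q - 1) ^ 2 = 1 + q * (q - 2)"
      proof -
        obtain r where "q = r + 2" using assms(2) by (metis add.commute le_add_diff_inverse less_imp_le)
        then show ?thesis by (simp add: power2_eq_square algebra_simps)
      qed
      then have "(q - 1) ^ 2 mod q = 1 mod q" by (metis mod_mult_self2)
      then show ?thesis using assms by simp
    qed
    then have "?f (q - 1) = ?f 1" using assms by simp
    moreover assume "inj_on ?f {1..<q}"
    ultimately have "q - 1 = 1" using assms by (elim inj_onD) auto
    then show False using assms by simp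
  qed
  moreover have "?f ` {1..<q} \<subseteq> {1..<q}"
  proof clarify
    fix i assume i: "i \<in> {1..<q}"
    then have "\<not> q dvd i" by (auto dest: dvd_imp_le)
    then have "\<not> q dvd i ^ 2" using assms prime_dvd_power by blast
    then show "?f i \<in> {1..<q}" using assms by (auto simp: dvd_eq_mod_eq_0 Suc_le_eq)
  qed
  ultimately have "?f ` {1..<q} \<noteq> {1..<q}" by (metis eq_card_imp_inj_on finite_atLeastLessThan)
  with \<open>?f ` {1..<q} \<subseteq> {1..<q}\<close> obtain b where b: "b \<in> {1..<q}" "b \<notin> ?f ` {1..<q}" by blast
  have nd: "\<not> int q dvd int b" using b by (auto dest: dvd_imp_le)
  have "\<not> QuadRes q b"
  proof
    assume "QuadRes q b"
    then obtain y where y: "[y ^ 2 = int b] (mod int q)" by (auto simp: QuadRes_def)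
    define i where "i = nat (y mod int q)"
    have i: "int i = y mod int q" using assms by (simp add: i_def)
    have "[int i ^ 2 = int b] (mod int q)" using y by (simp add: i cong_def power_mod)
    then have *: "i ^ 2 mod q = b" using b
      by (metis atLeastLessThan_iff cong_def cong_int_iff mod_less of_nat_power)
    have "i < q" using i assms by (metis of_nat_0_less_iff of_nat_less_iff pos_mod_bound prime_gt_0_nat)
    moreover have "i \<noteq> 0" using * b by auto
    ultimately show False using * b by (metis atLeastLessThan_iff image_eqI less_one not_less)
  qed
  with nd have "Legendre b q = -1" by (simp add: Legendre_def cong_0_iff)
  moreover have "coprime (int b) (int q)"
    using nd assms prime_imp_coprime[of "int q" "int b"] by (simp add: coprime_commute)
  ultimately show ?thesis using that by blast
qed

text \<open>Multiplying the index by a nonresidue permutes the residues and negates every term, so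
  the sum equals its own negative.\<close>

lemma sum_Legendre:
  fixes q :: nat
  assumes "prime q" "q > 2"
  shows "(\<Sum>i<q. Legendre (int i) (int q)) = 0"
proof -
  obtain b where b: "coprime b (int q)" "Legendre b q = -1"
    using exists_Legendre_nonresidue[OF assms] .
  have "(\<Sum>i<q. Legendre (int i) (int q)) = (\<Sum>i<q. Legendre (b * int i) (int q))"
    by (rule sum_residues_mult[symmetric]) (use b assms in auto)
  also have "\<dots> = - (\<Sum>i<q. Legendre (int i) (int q))"
    by (simp add: Legendre_mult[OF assms] b sum_negf)
  finally show ?thesis by simp
qed

text \<open>For \<open>q \<nmid> k\<close> the substitution \<open>i \<mapsto> k i\<close> shows that the sum does not depend on \<open>k\<close>; the
  common value follows since the sums over all residues \<open>k\<close> add up to \<open>0\<close>.\<close>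

lemma sum_Legendre_convolution:
  fixes q :: nat
  assumes q: "prime q" "[q = 1] (mod 4)"
  shows "(\<Sum>i<q. Legendre (int i) q * Legendre (k - int i) q) = (if int q dvd k then int q - 1 else -1)"
proof -
  define J where "J k = (\<Sum>i<q. Legendre (int i) q * Legendre (k - int i) q)" for k
  have q2: "q > 2"
  proof -
    have "q mod 4 = 1" "q \<noteq> 1" using q by (auto simp: cong_def)
    then show ?thesis by presburger
  qed
  have J0: "J k = int q - 1" if "int q dvd k" for k
  proof -
    \<comment> \<open>Since -1 is a residue, each term becomes the square of a Legendre symbol, and
      the \<open>q - 1\<close> nonzero residues contribute 1 each.\<close>
    have "Legendre (k - int i) q = Legendre (int i) q" for i
    proof -
      have "Legendre (k - int i) q = Legendre (- int i) q"
        by (rule Legendre_cong) (use that in \<open>simp add: cong_iff_dvd_diff\<close>)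
      then show ?thesis by (simp add: Legendre_minus[OF q])
    qed
    then have "J k = (\<Sum>i<q. Legendre (int i) q * Legendre (int i) q)" by (simp add: J_def)
    also have "\<dots> = (\<Sum>i<q. if i = 0 then 0 else 1)"
    proof (intro sum.cong refl)
      fix i assume "i \<in> {..<q}"
      then have "int q dvd int i \<longleftrightarrow> i = 0" by (auto dest: dvd_imp_le)
      then show "Legendre (int i) q * Legendre (int i) q = (if i = 0 then 0 else 1)"
        by (auto simp: Legendre_def cong_0_iff)
    qed
    also have "\<dots> = (\<Sum>i<q. 1 - (if i = 0 then 1 else 0))" by (rule sum.cong) auto
    also have "\<dots> = int q - 1" using q2 by (simp add: sum_subtractf)
    finally show ?thesis .
  qed
  have J1: "J k = J 1" if k: "\<not> int q dvd k" for k
  proof -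
    have cop: "coprime k (int q)"
      using k q prime_imp_coprime[of "int q" k] by (simp add: coprime_commute)
    have Legendre_diff_mod: "Legendre (k - a mod q) q = Legendre (k - a) q" for a :: int
      by (rule Legendre_cong) (simp add: cong_def mod_simps)
    have "J k = (\<Sum>i<q. Legendre (k * int i) q * Legendre (k - k * int i) q)"
      unfolding J_def
      by (rule sum_residues_mult[symmetric, where F="\<lambda>a. Legendre a q * Legendre (k - a) q"])
         (use cop q2 Legendre_diff_mod in simp_all)
    also have "\<dots> = (\<Sum>i<q. (Legendre k q * Legendre k q)
        * (Legendre (int i) q * Legendre (1 - int i) q))"
    proof (intro sum.cong refl)
      fix i
      have "k - k * int i = k * (1 - int i)" by (simp add: right_diff_distrib)
      then show "Legendre (k * int i) q * Legendre (k - k * int i) q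
          = (Legendre k q * Legendre k q) * (Legendre (int i) q * Legendre (1 - int i) q)"
        by (simp only: Legendre_mult[OF q(1) q2] mult_ac)
    qed
    also have "\<dots> = J 1" by (simp add: Legendre_square[OF k] J_def)
    finally show ?thesis .
  qed
  \<comment> \<open>After interchanging the sums, the inner one is a shifted full sum of Legendre
    symbols.\<close>
  have "(\<Sum>k<q. J (int k)) = (\<Sum>i<q. Legendre (int i) q * (\<Sum>k<q. Legendre (int k - int i) q))"
    unfolding J_def by (subst sum.swap) (simp add: sum_distrib_left)
  also have "\<dots> = 0"
  proof -
    have "(\<Sum>k<q. Legendre (int k - int i) q) = 0" for i
      using sum_residues_shift[of q "\<lambda>a. Legendre a q" "- int i"] sum_Legendre[OF q(1) q2] q2 by simp
    then show ?thesis by simp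
  qed
  finally have "0 = (\<Sum>k<q. J (int k))" ..
  \<comment> \<open>Only \<open>k = 0\<close> deviates from the common value, so the total is
    \<open>q J(1) + (q - 1 - J(1))\<close>, that is \<open>(q - 1) (J(1) + 1)\<close>.\<close>
  also have "\<dots> = (\<Sum>k<q. J 1 + (if k = 0 then int q - 1 - J 1 else 0))"
  proof (intro sum.cong refl)
    fix i assume "i \<in> {..<q}"
    then have "int q dvd int i \<longleftrightarrow> i = 0" by (auto dest: dvd_imp_le)
    then show "J (int i) = J 1 + (if i = 0 then int q - 1 - J 1 else 0)"
      using J0[of 0] J1[of "int i"] by simp
  qed
  also have "\<dots> = int q * (J 1 + 1) - (J 1 + 1)"
    using q2 by (simp add: sum.distrib algebra_simps)
  finally have "(int q - 1) * (J 1 + 1) = 0" by (metis left_diff_distrib mult_1)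
  then have "J 1 = -1" using q2 by simp
  then show ?thesis using J0 J1 by (auto simp: J_def)
qed

subsection \<open>Quadratic residue idempotents\<close>

definition all_ones_poly :: "nat \<Rightarrow> 'a::comm_ring_1 poly" where
  "all_ones_poly q = (\<Sum>i<q. monom 1 i)"

text \<open>This is \<open>j1 - j2\<close>, with a harmless zero coefficient at index 0. Written as
  one sum over all residues it admits reindexing modulo \<open>q\<close>; its value at a primitive
  \<open>q\<close>-th root of unity is the Gauss sum.\<close>

definition Legendre_poly :: "nat \<Rightarrow> 'a::comm_ring_1 poly" where
  "Legendre_poly q = (\<Sum>i<q. monom (of_int (Legendre (int i) (int q))) i)"

lemma monom_sum: "monom (sum f A) n = (\<Sum>i\<in>A. monom (f i) n)"
  by (induction A rule: infinite_finite_induct) (auto simp: add_monom[symmetric])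

text \<open>Multiplication by \<open>x^i\<close> permutes the monomials
  \<open>1, x, ..., x^(q-1)\<close> cyclically.\<close>

lemma cyc_cong_monom_all_ones:
  assumes "q > 0"
  shows "cyc_cong q (monom a i * all_ones_poly q) (smult a (all_ones_poly q))"
proof -
  let ?F = "\<lambda>z. monom a (nat (z mod int q))"
  have "monom a i * all_ones_poly q = (\<Sum>j<q. monom a (j + i))"
    by (simp add: all_ones_poly_def sum_distrib_left mult_monom add.commute)
  also have "cyc_cong q \<dots> (\<Sum>j<q. ?F (int j + int i))"
  proof (intro cyc_cong_sum cyc_cong_monom)
    fix j
    have "nat ((int j + int i) mod int q) = (j + i) mod q"
      by (simp flip: of_nat_add of_nat_mod)
    then show "[j + i = nat ((int j + int i) mod int q)] (mod q)" by (simp add: cong_def)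
  qed
  also have "\<dots> = (\<Sum>j<q. ?F (int j))"
    by (rule sum_residues_shift) (use assms in simp_all)
  also have "\<dots> = smult a (all_ones_poly q)"
    by (auto simp: all_ones_poly_def smult_sum2 smult_monom intro!: sum.cong)
  finally show ?thesis .
qed

lemma all_ones_poly_square:
  assumes "q > 0"
  shows "cyc_cong q (all_ones_poly q * all_ones_poly q) (smult (of_nat q) (all_ones_poly q))"
proof -
  have "all_ones_poly q * all_ones_poly q = (\<Sum>i<q. monom 1 i * all_ones_poly q)"
    by (subst (1) all_ones_poly_def) (rule sum_distrib_right)
  also have "cyc_cong q \<dots> (\<Sum>i<q. smult 1 (all_ones_poly q))"
    by (intro cyc_cong_sum cyc_cong_monom_all_ones assms)
  also have "\<dots> = smult (of_nat q) (all_ones_poly q)"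
    by (simp add: of_nat_poly)
  finally show ?thesis .
qed

text \<open>A product with the all-ones polynomial depends only on the sum of the coefficients of
  the other factor, which is 0 here.\<close>

lemma Legendre_poly_mult_all_ones:
  assumes "prime q" "q > 2"
  shows "cyc_cong q (Legendre_poly q * all_ones_poly q) 0"
proof -
  let ?c = "\<lambda>i. of_int (Legendre (int i) (int q))"
  have "Legendre_poly q * all_ones_poly q = (\<Sum>i<q. monom (?c i) i * all_ones_poly q)"
    by (subst (1) Legendre_poly_def) (rule sum_distrib_right)
  also have "cyc_cong q \<dots> (\<Sum>i<q. smult (?c i) (all_ones_poly q))"
    by (intro cyc_cong_sum cyc_cong_monom_all_ones) (use assms in simp)
  also have "\<dots> = smult (of_int (\<Sum>i<q. Legendre (int i) (int q))) (all_ones_poly q)"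
    by (simp add: smult_sum)
  also have "\<dots> = 0" by (simp add: sum_Legendre[OF assms])
  finally show ?thesis .
qed

lemma Legendre_poly_square:
  assumes "prime q" "[q = 1] (mod 4)"
  shows "cyc_cong q (Legendre_poly q * Legendre_poly q) ([:of_nat q:] - all_ones_poly q)"
proof -
  let ?c = "\<lambda>i. Legendre i (int q)"
  have q0: "q > 0" using assms(1) prime_gt_0_nat by blast
  \<comment> \<open>\<open>F i z\<close> is the contribution of index \<open>i\<close> to the
    coefficient of \<open>x^z\<close> under the substitution \<open>z = i + j\<close>. It is
    periodic in \<open>z\<close>, so the inner sum may be shifted by \<open>i\<close>.\<close>
  define F where "F i z = (monom (of_int (?c i * ?c (z - i))) (nat (z mod int q)) :: 'a poly)" for i z
  have F_mod: "F i (z mod int q) = F i z" for i z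
  proof -
    have "?c (z mod int q - i) = ?c (z - i)" by (rule Legendre_cong) (simp add: cong_def mod_simps)
    then show ?thesis by (simp add: F_def)
  qed
  have "Legendre_poly q * Legendre_poly q
      = (\<Sum>i<q. \<Sum>j<q. monom (of_int (?c (int i) * ?c (int j))) (i + j) :: 'a poly)"
    by (simp add: Legendre_poly_def sum_product mult_monom)
  also have "cyc_cong q \<dots> (\<Sum>i<q. \<Sum>j<q. F (int i) (int j + int i))"
  proof (intro cyc_cong_sum)
    fix i j
    have "nat ((int j + int i) mod int q) = (j + i) mod q"
      by (simp flip: of_nat_add of_nat_mod)
    then have "[i + j = nat ((int j + int i) mod int q)] (mod q)" by (simp add: cong_def add.commute)
    then show "cyc_cong q (monom (of_int (?c (int i) * ?c (int j))) (i + j)) (F (int i) (int j + int i))"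
      unfolding F_def by (simp add: cyc_cong_monom)
  qed
  also have "\<dots> = (\<Sum>i<q. \<Sum>j<q. F (int i) (int j))"
    by (intro sum.cong refl sum_residues_shift q0 F_mod)
  also have "\<dots> = (\<Sum>j<q. monom (of_int (\<Sum>i<q. ?c (int i) * ?c (int j - int i))) j)"
    by (subst sum.swap) (auto simp: F_def monom_sum intro!: sum.cong)
  \<comment> \<open>The convolution value, \<open>q - 1\<close> at 0 and -1 elsewhere, is split as
    \<open>q\<close> at 0 minus 1 everywhere.\<close>
  also have "\<dots> = (\<Sum>j<q. (if j = 0 then [:of_nat q:] else 0) - monom 1 j)"
  proof (intro sum.cong refl)
    fix j assume "j \<in> {..<q}"
    then have "int q dvd int j \<longleftrightarrow> j = 0" by (auto dest: dvd_imp_le)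
    then show "monom (of_int (\<Sum>i<q. ?c (int i) * ?c (int j - int i))) j
        = (if j = 0 then [:of_nat q:] else 0) - (monom 1 j :: 'a poly)"
      by (simp add: sum_Legendre_convolution[OF assms] minus_monom monom_0 one_pCons)
  qed
  also have "\<dots> = [:of_nat q:] - all_ones_poly q"
    using q0 by (simp add: sum_subtractf all_ones_poly_def)
  finally show ?thesis .
qed

text \<open>The substitution moves the coefficient at \<open>i\<close> to \<open>-i\<close> modulo
  \<open>q\<close>, which changes nothing when the coefficients form an even periodic
  function.\<close>

lemma cyc_rev_symmetric:
  assumes "q > 0" and F: "\<And>a. F (a mod int q) = F a" and minus: "\<And>a. F (- a) = F a"
  shows "cyc_cong q (cyc_rev q (\<Sum>i<q. monom (F (int i)) i)) (\<Sum>i<q. monom (F (int i)) i)"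
proof -
  have "cyc_rev q (\<Sum>i<q. monom (F (int i)) i) = (\<Sum>i<q. monom (F (int i)) ((q - 1) * i))"
    by (simp add: cyc_rev_sum cyc_rev_monom)
  also have "cyc_cong q \<dots> (\<Sum>i<q. monom (F (- 1 * int i)) (nat ((- 1 * int i) mod int q)))"
  proof (intro cyc_cong_sum)
    fix i
    have "[int ((q - 1) * i) = - 1 * int i] (mod int q)"
      using assms(1) by (simp add: cong_iff_dvd_diff of_nat_diff left_diff_distrib)
    then have "[int ((q - 1) * i) = int (nat ((- 1 * int i) mod int q))] (mod int q)"
      using assms(1) by (simp add: cong_def)
    then have "[(q - 1) * i = nat ((- 1 * int i) mod int q)] (mod q)"
      unfolding cong_int_iff .
    then show "cyc_cong q (monom (F (int i)) ((q - 1) * i))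
        (monom (F (- 1 * int i)) (nat ((- 1 * int i) mod int q)))"
      by (simp add: minus cyc_cong_monom)
  qed
  also have "\<dots> = (\<Sum>i<q. monom (F (int i)) (nat (int i mod int q)))"
    by (rule sum_residues_mult[where F="\<lambda>z. monom (F z) (nat (z mod int q))"])
       (use assms in simp_all)
  also have "\<dots> = (\<Sum>i<q. monom (F (int i)) i)" by (rule sum.cong) auto
  finally show ?thesis .
qed

lemma cyc_rev_all_ones_poly: "q > 0 \<Longrightarrow> cyc_cong q (cyc_rev q (all_ones_poly q)) (all_ones_poly q)"
  unfolding all_ones_poly_def by (rule cyc_rev_symmetric[where F="\<lambda>_. 1"]) simp_all

lemma cyc_rev_Legendre_poly:
  assumes "prime q" "[q = 1] (mod 4)"
  shows "cyc_cong q (cyc_rev q (Legendre_poly q)) (Legendre_poly q)"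
  unfolding Legendre_poly_def
  by (rule cyc_rev_symmetric[where F="\<lambda>a. of_int (Legendre a (int q))"])
     (use assms Legendre_minus[OF assms] prime_gt_0_nat in simp_all)

text \<open>The common shape of all generators. There is no division in \<open>R\<close>, so 1/2 and
  1/(2q) enter as parameters \<open>h\<close> and \<open>a\<close>, later pinned down by
  \<open>2 h = 1\<close> and \<open>2 q a = 1\<close>.\<close>

definition qr_poly :: "nat \<Rightarrow> 'a::comm_ring_1 \<Rightarrow> 'a \<Rightarrow> 'a \<Rightarrow> 'a poly" where
  "qr_poly q h a b = [:h:] + smult a (all_ones_poly q) + smult b (Legendre_poly q)"

text \<open>With \<open>s^2 = q s\<close>, \<open>s c = 0\<close> and \<open>c^2 = q - s\<close>,
  the square has constant term \<open>h^2 + q b^2 = h\<close>, coefficient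
  \<open>2 h a + q a^2 - b^2 = a\<close> at \<open>s\<close> and \<open>2 h b = b\<close> at
  \<open>c\<close>.\<close>

lemma qr_poly_idempotent:
  fixes h a b :: "'a::comm_ring_1"
  assumes "prime q" "[q = 1] (mod 4)"
    and h: "2 * h = 1" and a: "2 * of_nat q * a = 1" and b: "4 * of_nat q * (b * b) = 1"
  shows "cyc_cong q (qr_poly q h a b * qr_poly q h a b) (qr_poly q h a b)"
proof -
  let ?s = "all_ones_poly q :: 'a poly" and ?c = "Legendre_poly q :: 'a poly"
  have q2: "q > 2"
  proof -
    have "q mod 4 = 1" "q \<noteq> 1" using assms by (auto simp: cong_def)
    then show ?thesis by presburger
  qed
  have double: "h * x + h * x = x" for x
    using h by (metis mult.assoc mult.commute mult_1 mult_2)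
  have double': "2 * (x * h) = x" for x
    using h by (metis mult.left_commute mult.right_neutral)
  have ring_id: "(H + A * s + B * c) * (H + A * s + B * c) = H * H + (H * A + H * A) * s
      + (H * B + H * B) * c + A * A * (s * s) + B * B * (c * c) + (A * B + A * B) * (c * s)"
    for H A B s c :: "'a poly"
    by (simp add: algebra_simps)
  have "qr_poly q h a b * qr_poly q h a b = [:h * h:] + smult a ?s + smult b ?c
      + smult (a * a) (?s * ?s) + smult (b * b) (?c * ?c) + smult (a * b + a * b) (?c * ?s)"
    using ring_id[of "[:h:]" "[:a:]" ?s "[:b:]" ?c] by (simp add: qr_poly_def double double')
  also have "cyc_cong q \<dots> ([:h * h:] + smult a ?s + smult b ?c
      + smult (a * a) (smult (of_nat q) ?s) + smult (b * b) ([:of_nat q:] - ?s) + smult (a * b + a * b) 0)"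
    by (intro cyc_cong_add cyc_cong_smult cyc_cong_refl all_ones_poly_square Legendre_poly_square
        Legendre_poly_mult_all_ones) (use assms q2 in auto)
  also have "\<dots> = [:h * h + b * b * of_nat q:] + smult (a + (a * a * of_nat q - b * b)) ?s + smult b ?c"
    by (simp add: smult_diff_right smult_add_left smult_diff_left)
  also have "b * b * of_nat q = h * h"
  proof -
    \<comment> \<open>Inserting a factor equal to 1 replaces the division by 4; the same device
      gives \<open>q a^2 = b^2\<close> below.\<close>
    have "b * b * of_nat q = (2 * h) * (2 * h) * (b * b * of_nat q)" by (simp add: h)
    also have "\<dots> = h * h * (4 * of_nat q * (b * b))" by (simp add: algebra_simps)
    finally show ?thesis by (simp add: b)
  qed
  also have "h * h + h * h = h" by (rule double)
  also have "a * a * of_nat q - b * b = 0"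
  proof -
    have "b * b = (2 * of_nat q * a) * (2 * of_nat q * a) * (b * b)" by (simp add: a)
    also have "\<dots> = a * a * of_nat q * (4 * of_nat q * (b * b))" by (simp add: algebra_simps)
    finally show ?thesis by (simp add: b)
  qed
  finally show ?thesis by (simp add: qr_poly_def)
qed

lemma dual_code_qr_poly:
  fixes h a b :: "'a::comm_ring_1"
  assumes "prime q" "[q = 1] (mod 4)"
    and "2 * h = 1" "2 * of_nat q * a = 1" "4 * of_nat q * (b * b) = 1"
  shows "dual_code q (cyclic_code q (qr_poly q h a b)) = cyclic_code q (1 - qr_poly q h a b)"
proof (rule dual_code_idempotent)
  show "q > 0" using assms(1) prime_gt_0_nat by blast
  then show "cyc_cong q (cyc_rev q (qr_poly q h a b)) (qr_poly q h a b)"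
    unfolding qr_poly_def cyc_rev_add cyc_rev_smult cyc_rev_const
    by (intro cyc_cong_add cyc_cong_smult cyc_cong_refl cyc_rev_all_ones_poly
        cyc_rev_Legendre_poly assms)
qed (rule qr_poly_idempotent[OF assms])

subsection \<open>The Gauss sum and the codes over \<open>R\<close>\<close>

lemma u_const_0: "u_const 0 = 0" and u_const_1: "u_const 1 = 1"
  by (simp_all add: u_const_def zero_u_ring.abs_eq one_u_ring.abs_eq one_pCons)

lemma u_const_add: "u_const (x + y) = u_const x + u_const y"
  and u_const_mult: "u_const (x * y) = u_const x * u_const y"
  by (simp_all add: u_const_def plus_u_ring.abs_eq times_u_ring.abs_eq mult.commute)

interpretation u_const: comm_ring_hom u_const
  by unfold_locales (rule u_const_0 u_const_1 u_const_add u_const_mult)+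

text \<open>The elements \<open>x u\<close>, \<open>z u^2\<close> and \<open>u^3\<close> multiply
  like a cyclic group of order 3 with identity \<open>u^3\<close>. Their sum \<open>s\<close>
  therefore satisfies \<open>s^2 = 3 s\<close> and \<open>u^3 s = s\<close>.\<close>

lemma eta_idempotent_aux:
  fixes u t x z :: "'a::comm_ring_1"
  assumes u: "u ^ 4 = u" and t: "3 * t = 1" and x: "x * x = z" "x * z = 1" "z * z = x"
  defines "y \<equiv> t * (x * u + z * u ^ 2 + u ^ 3)"
  shows "y * y = y" "(1 - u ^ 3) * y = 0"
proof -
  define w v where "w = u ^ 2" and "v = u ^ 3"
  have tab: "u * u = w" "u * w = v" "u * v = u" "w * w = u" "v * w = w" "v * v = v"
    using u by (simp_all add: w_def v_def eval_nat_numeral ac_simps)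
  \<comment> \<open>The multiplication table with a trailing factor, since normalized products are
    nested to the right.\<close>
  have tab': "u * (u * r) = w * r" "u * (w * r) = v * r" "u * (v * r) = u * r"
    "w * (w * r) = u * r" "v * (w * r) = w * r" "v * (v * r) = v * r"
    "x * (x * r) = z * r" "x * (z * r) = r" "z * (z * r) = x * r" for r
    using tab x by (simp_all flip: mult.assoc)
  define s where "s = x * u + z * w + v"
  have y: "y = t * s" by (simp add: y_def s_def w_def v_def)
  have "s * s = s + s + s"
    unfolding s_def by (simp add: distrib_left distrib_right mult_ac tab tab' x add_ac)
  then have "s * s = 3 * s" by simp
  have "y * y = t * t * (s * s)" by (simp only: y mult_ac)
  also have "\<dots> = t * (3 * t) * s" by (simp only: \<open>s * s = 3 * s\<close> mult_ac)
  finally show "y * y = y" by (simp add: t y)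
  have "v * s = s"
    unfolding s_def by (simp add: distrib_left mult_ac tab tab' x add_ac)
  then have "(1 - v) * s = 0" by (simp add: left_diff_distrib)
  then show "(1 - u ^ 3) * y = 0" unfolding v_def[symmetric] y by (simp add: mult.left_commute)
qed

lemma eta_idempotent:
  fixes \<xi> :: "'p::prime_card mod_ring"
  assumes \<xi>: "primitive_root_of_unity 3 \<xi>" and "(3 :: 'p mod_ring) \<noteq> 0" and "i \<in> {1..4}"
  shows "eta \<xi> i * eta \<xi> i = eta \<xi> i"
    and "i \<noteq> 1 \<Longrightarrow> eta \<xi> 1 * eta \<xi> i = 0"
proof -
  let ?t = "u_const (inverse 3) :: 'p u_ring" and ?x = "u_const \<xi>"
  have t: "3 * ?t = 1"
  proof -
    have "u_const (3 * inverse 3) = 3 * ?t" by (simp only: u_const.hom_mult u_const.hom_numeral)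
    then show ?thesis using assms(2) by simp
  qed
  have \<xi>2: "\<xi> ^ 2 + \<xi> + 1 = 0"
  proof -
    have "\<xi> ^ 3 = 1" "\<xi> ^ 1 \<noteq> 1" using \<xi> by (auto simp only: primitive_root_of_unity_def)
    moreover have "(\<xi> - 1) * (\<xi> ^ 2 + \<xi> + 1) = \<xi> ^ 3 - 1"
      by (simp add: algebra_simps eval_nat_numeral)
    ultimately show ?thesis by simp
  qed
  have "\<xi> * \<xi> ^ 2 = 1"
    using \<xi> by (simp add: primitive_root_of_unity_def eval_nat_numeral)
  then have "u_const (\<xi> * \<xi> ^ 2) = 1" by simp
  then have x12: "?x * ?x ^ 2 = 1" by (simp only: u_const.hom_mult u_const.hom_power)
  have "?x ^ 2 * ?x ^ 2 = (?x * ?x ^ 2) * ?x" by (simp add: power2_eq_square mult_ac)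
  then have x: "?x * ?x = ?x ^ 2" "?x * ?x ^ 2 = 1" "?x ^ 2 * ?x ^ 2 = ?x" "?x ^ 2 * ?x = 1"
    using x12 by (simp_all only: power2_eq_square mult_1 mult.commute)
  have u3: "(1 - u_var ^ 3) * (1 - u_var ^ 3) = (1 - u_var ^ 3 :: 'p u_ring)"
  proof -
    have "u_var ^ 3 * u_var ^ 3 = (u_var ^ 4 * u_var ^ 2 :: 'p u_ring)"
      by (simp flip: power_add)
    also have "\<dots> = u_var ^ 3" unfolding u_var_power4 by (simp add: eval_nat_numeral)
    finally show ?thesis by (simp add: left_diff_distrib right_diff_distrib)
  qed
  note aux = eta_idempotent_aux[OF u_var_power4 t]
  \<comment> \<open>The pairs \<open>(x, z)\<close> are \<open>(1, 1)\<close>,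
    \<open>(\<xi>, \<xi>^2)\<close> and \<open>(\<xi>^2, \<xi>)\<close>, giving \<open>eta\<close>
    with index 2, 3 and 4.\<close>
  note e = u3 aux[of 1 1, simplified] aux[OF x(1-3)] aux[OF x(3,4,1)]
  have "i = 1 \<or> i = 2 \<or> i = 3 \<or> i = 4" using assms(3) by auto
  then show "eta \<xi> i * eta \<xi> i = eta \<xi> i" "i \<noteq> 1 \<Longrightarrow> eta \<xi> 1 * eta \<xi> i = 0"
    using e by (auto simp: eta_def u_const.hom_power)
qed

section \<open>The Gauss sum as a square root of \<open>q\<close> in \<open>F_p\<close>\<close>

lemma of_nat_mod_ring_neq_0:
  assumes "\<not> CARD('p) dvd n"
  shows "(of_nat n :: 'p::prime_card mod_ring) \<noteq> 0"
  using assms of_nat_0_mod_ring_dvd by blast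

lemma quadratic_residue_swap:
  fixes p q :: nat
  assumes "prime p" "p > 2" "prime q" "[q = 1] (mod 4)" "\<not> q dvd p" "QuadRes (int q) (int p)"
  shows "QuadRes (int p) (int q)"
proof -
  have "q mod 4 = 1" "q \<noteq> 1" using assms by (auto simp: cong_def)
  then have q: "q > 2" "even ((q - 1) div 2)" by presburger+
  have "p \<noteq> q" using assms by auto
  have "Legendre p q * Legendre q p = (-1) ^ ((p - 1) div 2 * ((q - 1) div 2))"
    by (rule Quadratic_Reciprocity) (use assms q \<open>p \<noteq> q\<close> in auto)
  also have "\<dots> = 1" using q by simp
  also have "Legendre p q = 1"
    using assms by (simp add: Legendre_def cong_0_iff)
  finally show ?thesis by (auto simp: Legendre_def split: if_splits)
qed

lemma sum_powers_root_of_unity: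
  fixes x :: "'a::idom"
  assumes "x ^ q = 1" "x \<noteq> 1"
  shows "(\<Sum>i<q. x ^ i) = 0"
  using power_diff_1_eq[of x q] assms by simp

text \<open>\<open>of_ac\<close> inverts \<open>to_ac\<close> only on the image of
  \<open>F_p\<close>, so the Gauss sum must first be located there. It has the same square as a root
  of \<open>q\<close> in \<open>F_p\<close>, hence agrees with it up to sign.\<close>

lemma theta_square:
  fixes \<alpha> :: "'p::prime_card mod_ring alg_closure"
  assumes p: "CARD('p) > 2" and q: "prime q" "[q = 1] (mod 4)"
    and res: "\<not> q dvd CARD('p)" "QuadRes (int q) (int CARD('p))"
    and \<alpha>: "primitive_root_of_unity q \<alpha>"
  shows "theta q \<alpha> * theta q \<alpha> = (of_nat q :: 'p mod_ring)"
proof -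
  have "q > 1" using q(1) prime_gt_1_nat by blast
  then have "\<alpha> ^ q = 1" "\<alpha> ^ 1 \<noteq> 1"
    using \<alpha> unfolding primitive_root_of_unity_def by (blast, meson less_numeral_extra(1))
  then have \<alpha>': "\<alpha> ^ q = 1" "\<alpha> \<noteq> 1" by simp_all
  define g where "g = poly (Legendre_poly q) \<alpha>"
  have g: "g = (\<Sum>i = 1..q - 1. of_int (Legendre (int i) (int q)) * \<alpha> ^ i)"
  proof -
    have "g = (\<Sum>i<q. of_int (Legendre (int i) (int q)) * \<alpha> ^ i)"
      by (simp add: g_def Legendre_poly_def poly_sum poly_monom)
    also have "\<dots> = (\<Sum>i = 1..q - 1. of_int (Legendre (int i) (int q)) * \<alpha> ^ i)"
      by (rule sum.mono_neutral_right) (auto simp: Legendre_def Suc_le_eq)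
    finally show ?thesis .
  qed
  \<comment> \<open>At \<open>\<alpha>\<close> both \<open>x^q - 1\<close> and the all-ones
    polynomial vanish, leaving \<open>g^2 = q\<close>.\<close>
  obtain f where "Legendre_poly q * Legendre_poly q - ([:of_nat q:] - all_ones_poly q)
      = (monom 1 q - 1) * (f :: 'p mod_ring alg_closure poly)"
    using Legendre_poly_square[OF q] unfolding cyc_cong_def by (elim dvdE)
  from arg_cong[OF this, of "\<lambda>f. poly f \<alpha>"] have gg: "g * g = of_nat q"
    by (simp add: g_def \<alpha>' poly_monom all_ones_poly_def poly_sum sum_powers_root_of_unity)
  have "QuadRes (int CARD('p)) (int q)"
    by (rule quadratic_residue_swap) (use p q res prime_card in auto)
  then obtain y where "[y ^ 2 = int q] (mod int CARD('p))" by (auto simp: QuadRes_def)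
  then have "of_int (y ^ 2) = (of_int (int q) :: 'p mod_ring)"
    by (simp only: of_int_eq_iff_cong_CHAR semiring_char_mod_ring)
  then have y: "of_int y * of_int y = (of_nat q :: 'p mod_ring)" by (simp add: power2_eq_square)
  define r where "r = (of_int y :: 'p mod_ring)"
  have "to_ac r * to_ac r = of_nat q" using arg_cong[OF y, of to_ac] by (simp add: r_def)
  with gg have "(g - to_ac r) * (g + to_ac r) = 0" by (simp add: algebra_simps)
  then have "g = to_ac r \<or> g = to_ac (- r)" by (auto simp: eq_neg_iff_add_eq_0)
  then have "theta q \<alpha> = r \<or> theta q \<alpha> = - r"
    unfolding theta_def g[symmetric] by (metis of_ac_to_ac)
  then show ?thesis using y by (auto simp: r_def)
qed

section \<open>The generators in the form \<open>qr_poly\<close>\<close>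

lemma all_ones_poly_eq:
  assumes "q > 0"
  shows "all_ones_poly q = 1 + (j1 q + j2 q)"
proof -
  have "{..<q} = insert 0 (quad_residues q \<union> quad_nonresidues q)"
    using assms by (auto simp: quad_residues_def quad_nonresidues_def)
  moreover have "0 \<notin> quad_residues q \<union> quad_nonresidues q"
    "quad_residues q \<inter> quad_nonresidues q = {}"
    "finite (quad_residues q)" "finite (quad_nonresidues q)"
    by (auto simp: quad_residues_def quad_nonresidues_def)
  ultimately show ?thesis
    by (simp add: all_ones_poly_def j1_def j2_def sum.union_disjoint monom_0 one_pCons)
qed

lemma Legendre_poly_eq:
  assumes "q > 0"
  shows "Legendre_poly q = j1 q - j2 q"
proof -
  have split: "{..<q} = insert 0 (quad_residues q \<union> quad_nonresidues q)"
    using assms by (auto simp: quad_residues_def quad_nonresidues_def)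
  have fin: "0 \<notin> quad_residues q \<union> quad_nonresidues q"
    "quad_residues q \<inter> quad_nonresidues q = {}"
    "finite (quad_residues q)" "finite (quad_nonresidues q)"
    by (auto simp: quad_residues_def quad_nonresidues_def)
  have L: "Legendre (int i) (int q) = (if i \<in> quad_residues q then 1 else -1)"
    if "i \<in> quad_residues q \<union> quad_nonresidues q" for i
    using that by (auto simp: quad_residues_def quad_nonresidues_def Legendre_def cong_0_iff dest: dvd_imp_le)
  have "Legendre_poly q = (\<Sum>i\<in>quad_residues q. monom (of_int (Legendre (int i) (int q))) i)
      + (\<Sum>i\<in>quad_nonresidues q. monom (of_int (Legendre (int i) (int q))) i)"
    using fin by (simp add: Legendre_poly_def split sum.union_disjoint) (simp add: Legendre_def)
  also have "(\<Sum>i\<in>quad_residues q. monom (of_int (Legendre (int i) (int q))) i) = j1 q"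
    using L by (auto simp: j1_def intro!: sum.cong)
  also have "(\<Sum>i\<in>quad_nonresidues q. monom (of_int (Legendre (int i) (int q))) i) = - j2 q"
    using L fin(2) by (auto simp: j2_def minus_monom sum_negf[symmetric] intro!: sum.cong)
  finally show ?thesis by simp
qed

lemma e1_e2_qr_poly:
  fixes \<theta> :: "'p::prime_card mod_ring"
  assumes "q > 0" "(2 :: 'p mod_ring) \<noteq> 0"
  defines "h \<equiv> 1 / 2" and "a \<equiv> 1 / (2 * of_nat q)" and "b \<equiv> 1 / (2 * \<theta>)"
  shows "e1 q \<theta> = qr_poly q h a (- b)" "e2 q \<theta> = qr_poly q h a b"
    "e1_tilde q \<theta> = 1 - qr_poly q h a b" "e2_tilde q \<theta> = 1 - qr_poly q h a (- b)"
proof -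
  \<comment> \<open>Writing 1 as 1/2 + 1/2 lets the constant terms 1/2 - 1/(2q) of the complements
    match.\<close>
  have half: "1 = [:1/2 + 1/2:: 'p mod_ring:]" using assms(2) by (simp add: one_pCons)
  note defs = e1_def e2_def e1_tilde_def e2_tilde_def qr_poly_def all_ones_poly_eq[OF assms(1)]
     Legendre_poly_eq[OF assms(1)] h_def a_def b_def
  show "e1 q \<theta> = qr_poly q h a (- b)" "e2 q \<theta> = qr_poly q h a b"
    by (simp_all add: defs smult_add_right smult_diff_right smult_add_left smult_diff_left
       one_pCons algebra_simps)
  show "e1_tilde q \<theta> = 1 - qr_poly q h a b" "e2_tilde q \<theta> = 1 - qr_poly q h a (- b)"
    by (subst half; simp add: defs smult_add_right smult_diff_right smult_add_left smult_diff_left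
       one_pCons algebra_simps)+
qed

lemma map_poly_u_const_qr_poly:
  "map_poly u_const (qr_poly q h a b) = qr_poly q (u_const h) (u_const a) (u_const b)"
proof -
  interpret map_poly_comm_ring_hom u_const ..
  show ?thesis
    by (simp add: qr_poly_def all_ones_poly_def Legendre_poly_def hom_distribs map_poly_monom
        u_const.map_poly_pCons_hom)
qed

text \<open>The two generators differ only in the sign of \<open>b\<close>, and the weights add up
  to 1, so only the multiplier of the Legendre polynomial changes, by the factor
  \<open>1 - 2 y\<close>.\<close>

lemma qr_poly_combination:
  fixes y h a b :: "'a::comm_ring_1"
  shows "smult (1 - y) (qr_poly q h a (- b)) + smult y (qr_poly q h a b)
      = qr_poly q h a (- ((1 - y - y) * b))"
proof -
  have "(1 - Y) * (H + A * s + - B * c) + Y * (H + A * s + B * c)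
      = H + A * s + - ((1 - Y - Y) * B) * c" for Y H A B s c :: "'a poly"
    by (simp add: algebra_simps)
  from this[of "[:y:]" "[:h:]" "[:a:]" "all_ones_poly q" "[:b:]" "Legendre_poly q"]
  show ?thesis by (simp add: qr_poly_def one_pCons mult.commute)
qed

text \<open>For idempotent \<open>y\<close> the factor \<open>1 - 2 y\<close> has square 1, so the
  condition on \<open>b\<close> survives and the combination is again a symmetric idempotent. The
  complement is arranged for the tilde generators, which will be \<open>1 - E2\<close> and
  \<open>1 - E1\<close> in this order.\<close>

lemma dual_code_combination:
  fixes y h a b :: "'a::comm_ring_1"
  assumes "prime q" "[q = 1] (mod 4)"
    and "2 * h = 1" "2 * of_nat q * a = 1" "4 * of_nat q * (b * b) = 1" and y: "y * y = y"
  defines "E1 \<equiv> qr_poly q h a (- b)" and "E2 \<equiv> qr_poly q h a b"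
  shows "dual_code q (cyclic_code q (smult (1 - y) E1 + smult y E2))
      = cyclic_code q (smult y (1 - E2) + smult (1 - y) (1 - E1))"
proof -
  let ?b = "- ((1 - y - y) * b)"
  have "(1 - y - y) * (1 - y - y) = 1"
    by (simp add: left_diff_distrib right_diff_distrib y)
  moreover have "4 * of_nat q * (?b * ?b) = (1 - y - y) * (1 - y - y) * (4 * of_nat q * (b * b))"
    by (simp only: minus_mult_minus mult_ac)
  ultimately have "4 * of_nat q * (?b * ?b) = 1" using assms(5) by simp
  then have "dual_code q (cyclic_code q (qr_poly q h a ?b)) = cyclic_code q (1 - qr_poly q h a ?b)"
    by (intro dual_code_qr_poly assms)
  also have "1 - qr_poly q h a ?b = smult y (1 - E2) + smult (1 - y) (1 - E1)"
    unfolding qr_poly_combination[symmetric] E1_def E2_def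
    by (simp add: smult_diff_right smult_diff_left)
  finally show ?thesis unfolding E1_def E2_def qr_poly_combination .
qed

theorem theorem10:
  fixes p q :: nat
    and \<xi> :: "'p::prime_card mod_ring"
    and \<alpha> :: "'p mod_ring alg_closure"
  assumes "CARD('p) = p"
    and "prime p" and "[p = 1] (mod 3)"
    and "prime q" and "[q = 1] (mod 4)"
    and "\<not> q dvd p" and "QuadRes (int q) (int p)"
    and "primitive_root_of_unity 3 \<xi>"
    and "primitive_root_of_unity q \<alpha>"
  shows "(\<forall>i\<in>{1..4}. dual_code q (Q_code q \<xi> \<alpha> i) = S_code q \<xi> \<alpha> (i + 4)
            \<and> dual_code q (Q_code q \<xi> \<alpha> (i + 4)) = S_code q \<xi> \<alpha> i)
       \<and> (\<forall>j\<in>{9..11}. dual_code q (Q_code q \<xi> \<alpha> j) = S_code q \<xi> \<alpha> (j + 3)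
            \<and> dual_code q (Q_code q \<xi> \<alpha> (j + 3)) = S_code q \<xi> \<alpha> j)"
proof -
  have p: "p > 3"
  proof -
    have "p mod 3 = 1" "p \<noteq> 1" using assms(2,3) by (auto simp: cong_def)
    then show ?thesis by presburger
  qed
  have q0: "q > 0" using assms(4) prime_gt_0_nat by blast
  have two: "(2 :: 'p mod_ring) \<noteq> 0" and three: "(3 :: 'p mod_ring) \<noteq> 0"
  proof -
    have "\<not> CARD('p) dvd 2" "\<not> CARD('p) dvd 3" using p assms(1) by (auto dest: dvd_imp_le)
    from this[THEN of_nat_mod_ring_neq_0] show "(2 :: 'p mod_ring) \<noteq> 0" "(3 :: 'p mod_ring) \<noteq> 0"
      by simp_all
  qed
  have "\<not> p dvd q" using assms(2,4,6) by (metis primes_dvd_imp_eq dvd_refl)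
  then have qn0: "(of_nat q :: 'p mod_ring) \<noteq> 0"
    using of_nat_mod_ring_neq_0[of q, where 'p='p] assms(1) by blast
  define \<theta> where "\<theta> = theta q \<alpha>"
  have \<theta>: "\<theta> * \<theta> = of_nat q"
    unfolding \<theta>_def by (rule theta_square) (use assms p in auto)
  define h where "h = u_const (1 / 2 :: 'p mod_ring)"
  define a where "a = u_const (1 / (2 * of_nat q) :: 'p mod_ring)"
  define b where "b = u_const (1 / (2 * \<theta>))"
  define E1 where "E1 = qr_poly q h a (- b)"
  define E2 where "E2 = qr_poly q h a b"
  have E: "map_poly u_const (e1 q \<theta>) = E1" "map_poly u_const (e2 q \<theta>) = E2"
    "map_poly u_const (e1_tilde q \<theta>) = 1 - E2" "map_poly u_const (e2_tilde q \<theta>) = 1 - E1"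
  proof -
    interpret map_poly_comm_ring_hom "u_const :: 'p mod_ring \<Rightarrow> _" ..
    show "map_poly u_const (e1 q \<theta>) = E1" "map_poly u_const (e2 q \<theta>) = E2"
      "map_poly u_const (e1_tilde q \<theta>) = 1 - E2" "map_poly u_const (e2_tilde q \<theta>) = 1 - E1"
      by (simp_all add: e1_e2_qr_poly[OF q0 two] E1_def E2_def h_def a_def b_def
          map_poly_u_const_qr_poly u_const.hom_uminus hom_minus)
  qed
  have h: "2 * h = 1"
  proof -
    have "u_const (2 * (1 / 2)) = 2 * h" unfolding h_def by (simp only: u_const.hom_mult u_const.hom_numeral)
    then show ?thesis using two by simp
  qed
  have a: "2 * of_nat q * a = 1"
  proof -
    have "u_const (2 * of_nat q * (1 / (2 * of_nat q))) = 2 * of_nat q * a" unfolding a_def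
      by (simp only: u_const.hom_mult u_const.hom_numeral u_const.hom_of_nat)
    then show ?thesis using two qn0 by simp
  qed
  have b: "4 * of_nat q * (b * b) = 1"
  proof -
    \<comment> \<open>This is \<open>\<theta>^2 = q\<close>; the instance of
      \<open>mult_eq_0_iff\<close> provides that 4 is nonzero.\<close>
    have "4 * of_nat q * (1 / (2 * \<theta>) * (1 / (2 * \<theta>))) = 1"
      using two qn0 mult_eq_0_iff[of 2 "2 :: 'p mod_ring"] by (simp flip: \<theta>)
    then have "u_const (4 * of_nat q * (1 / (2 * \<theta>) * (1 / (2 * \<theta>)))) = 1" by simp
    then show ?thesis unfolding b_def
      by (simp only: u_const.hom_mult u_const.hom_numeral u_const.hom_of_nat)
  qed
  note eta = eta_idempotent[OF assms(8) three]
  have dual: "dual_code q (cyclic_code q (smult (1 - y) E1 + smult y E2))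
        = cyclic_code q (smult y (1 - E2) + smult (1 - y) (1 - E1))"
    "dual_code q (cyclic_code q (smult y E1 + smult (1 - y) E2))
        = cyclic_code q (smult (1 - y) (1 - E2) + smult y (1 - E1))"
    if "y * y = y" for y
  proof -
    \<comment> \<open>Exchanging the roles of the two generators amounts to replacing
      \<open>y\<close> by the idempotent \<open>1 - y\<close>.\<close>
    have "(1 - y) * (1 - y) = 1 - y" using that by (simp add: algebra_simps)
    then show "dual_code q (cyclic_code q (smult (1 - y) E1 + smult y E2))
        = cyclic_code q (smult y (1 - E2) + smult (1 - y) (1 - E1))"
      "dual_code q (cyclic_code q (smult y E1 + smult (1 - y) E2))
        = cyclic_code q (smult (1 - y) (1 - E2) + smult y (1 - E1))"
      using dual_code_combination[OF assms(4,5) h a b, of y]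
        dual_code_combination[OF assms(4,5) h a b, of "1 - y"] that
      by (simp_all add: E1_def E2_def)
  qed
  note codes = Q_code_def S_code_def qr_generator_def Let_def E \<theta>_def[symmetric]
  show ?thesis
  proof (intro conjI ballI)
    fix i :: nat assume "i \<in> {1..4}"
    \<comment> \<open>These memberships decide the case distinctions in
      \<open>qr_generator\<close>.\<close>
    then have i: "i \<in> {1..4}" "i + 4 \<notin> {1..4}" "i + 4 \<in> {5..8}" "i + 4 - 4 = i" by auto
    from dual[OF eta(1)[OF i(1)]] show "dual_code q (Q_code q \<xi> \<alpha> i) = S_code q \<xi> \<alpha> (i + 4)"
      "dual_code q (Q_code q \<xi> \<alpha> (i + 4)) = S_code q \<xi> \<alpha> i"
      by (simp_all only: codes i if_True if_False)
  next
    fix j :: nat assume "j \<in> {9..11}"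
    then have j: "j \<notin> {1..4}" "j \<notin> {5..8}" "j \<in> {9..11}" "j + 3 \<notin> {1..4}" "j + 3 \<notin> {5..8}"
      "j + 3 \<notin> {9..11}" "j + 3 \<in> {12..14}" "j + 3 - 10 = j - 7" "j - 7 \<in> {1..4}" "j - 7 \<noteq> 1" by auto
    define y where "y = eta \<xi> 1 + eta \<xi> (j - 7)"
    have y': "1 - eta \<xi> 1 - eta \<xi> (j - 7) = 1 - y" by (simp add: y_def)
    \<comment> \<open>A sum of two orthogonal idempotents is idempotent.\<close>
    have "y * y = y" unfolding y_def using eta(1)[of 1] eta(1)[OF j(9)] eta(2)[OF j(9,10)]
      by (simp add: algebra_simps)
    from dual[OF this] show "dual_code q (Q_code q \<xi> \<alpha> j) = S_code q \<xi> \<alpha> (j + 3)"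
      "dual_code q (Q_code q \<xi> \<alpha> (j + 3)) = S_code q \<xi> \<alpha> j"
      by (simp_all only: codes j if_True if_False y' y_def[symmetric] add.commute)
  qed
qed

end
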